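(* Let $p$ be an odd prime number, let $K/\mathbb{Q}_p$ be a finite extension with residue field of cardinality $q$, and let $t\geq 1$ be an integer. Then $$B_1(t,K)\geq (2t-1)(q-1).$$
   Context: For a field $K$ and an integer $t\geq 0$, $B_1(t,K)$ denotes the supremum of the number of roots in $K^\ast=K\setminus\{0\}$, counted without multiplicities (i.e. distinct roots), that a non-zero polynomial in $K[x]$ with at most $t+1$ monomial terms can have. *)

theory Defs
  imports
    "HOL-Computational_Algebra.Computational_Algebra"
    "HOL-Library.Extended_Nat"
    "HOL-Analysis.Abstract_Metric_Spaces"
begin

definition num_terms :: "'a::zero poly \<Rightarrow> nat" where
  "num_terms f = card {i. coeff f i \<noteq> 0}"

text \<open>
  The number of nonzero roots is finite for each nonzero polynomial, so \<^const>\<open>card\<close> counts the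
  distinct roots correctly; the supremum is taken in \<^typ>\<open>enat\<close> because it may be infinite.
  The field is the carrier of the type \<open>'a\<close>.
\<close>
definition B1 :: "nat \<Rightarrow> 'a::field itself \<Rightarrow> enat" where
  "B1 t K = (SUP f \<in> {f :: 'a poly. f \<noteq> 0 \<and> num_terms f \<le> t + 1}.
               enat (card {x. x \<noteq> 0 \<and> poly f x = 0}))"

definition padic_abs :: "nat \<Rightarrow> rat \<Rightarrow> real" where
  "padic_abs p r =
     (if r = 0 then 0
      else case quotient_of r of (a, b) \<Rightarrow>
        real p powi (int (multiplicity (int p) b) - int (multiplicity (int p) a)))"

definition nonarch_abs :: "('a::field \<Rightarrow> real) \<Rightarrow> bool" where
  "nonarch_abs v \<longleftrightarrow>
     (\<forall>x. v x \<ge> 0) \<and> (\<forall>x. v x = 0 \<longleftrightarrow> x = 0) \<and>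
     (\<forall>x y. v (x * y) = v x * v y) \<and> (\<forall>x y. v (x + y) \<le> max (v x) (v y))"

definition is_subfield :: "'a::field set \<Rightarrow> bool" where
  "is_subfield F \<longleftrightarrow>
     1 \<in> F \<and> (\<forall>x\<in>F. \<forall>y\<in>F. x - y \<in> F \<and> x * y \<in> F) \<and> (\<forall>x\<in>F. inverse x \<in> F)"

text \<open>
  The field of \<open>p\<close>-adic numbers, as a subfield \<open>F\<close> of an ambient field with absolute value \<open>v\<close>:
  \<open>(F, v)\<close> is the completion of the rationals with respect to the \<open>p\<close>-adic absolute value, i.e.
  \<open>v\<close> restricts to the \<open>p\<close>-adic absolute value on the rationals, the rationals are dense in \<open>F\<close>,
  and \<open>F\<close> is complete.  This determines \<open>(F, v)\<close> up to a unique isomorphism of valued fields.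
\<close>
definition is_padic_numbers :: "nat \<Rightarrow> 'a::field_char_0 set \<Rightarrow> ('a \<Rightarrow> real) \<Rightarrow> bool" where
  "is_padic_numbers p F v \<longleftrightarrow>
     is_subfield F \<and>
     (\<forall>r. v (of_rat r) = padic_abs p r) \<and>
     (\<forall>x\<in>F. \<forall>e>0. \<exists>r. v (x - of_rat r) < e) \<and>
     Metric_space.mcomplete F (\<lambda>x y. v (x - y))"

text \<open>The whole type, as a vector space over \<open>F\<close>, is spanned by a finite set.\<close>
definition finite_extension_of :: "'a::field set \<Rightarrow> bool" where
  "finite_extension_of F \<longleftrightarrow>
     (\<exists>B. finite B \<and> (\<forall>x. \<exists>c. (\<forall>b\<in>B. c b \<in> F) \<and> x = (\<Sum>b\<in>B. c b * b)))"

text \<open>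
  A finite extension \<open>K\<close> of the \<open>p\<close>-adic numbers \<open>Q\<^sub>p\<close>, where \<open>K\<close> is the type \<open>'a\<close> and \<open>Q\<^sub>p\<close> its
  subset \<open>F\<close>.  The argument \<open>v\<close> is the extension to \<open>K\<close> of the \<open>p\<close>-adic absolute value of \<open>Q\<^sub>p\<close>;
  by the classical extension theorem it exists and is unique, so it is no further datum.
\<close>
definition padic_finite_extension :: "nat \<Rightarrow> 'a::field_char_0 set \<Rightarrow> ('a \<Rightarrow> real) \<Rightarrow> bool" where
  "padic_finite_extension p F v \<longleftrightarrow>
     nonarch_abs v \<and> is_padic_numbers p F v \<and> finite_extension_of F"

definition valuation_ring :: "('a::field \<Rightarrow> real) \<Rightarrow> 'a set" where
  "valuation_ring v = {x. v x \<le> 1}"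

definition maximal_ideal :: "('a::field \<Rightarrow> real) \<Rightarrow> 'a set" where
  "maximal_ideal v = {x. v x < 1}"

text \<open>Underlying set of the quotient of the valuation ring by its maximal ideal.\<close>
definition residue_field :: "('a::field \<Rightarrow> real) \<Rightarrow> 'a set set" where
  "residue_field v =
     valuation_ring v //
       {(x, y). x \<in> valuation_ring v \<and> y \<in> valuation_ring v \<and> x - y \<in> maximal_ideal v}"

end

theory Submission
  imports Defs
begin

text \<open>
  Write \<open>N = q - 1\<close>. The field \<open>K\<close> contains \<open>N\<close> roots of unity of order dividing \<open>N\<close>
  (\<open>card_roots_of_unity_ge\<close>), so every nonzero \<open>N\<close>-th power of \<open>K\<close> has \<open>N\<close> roots \<open>x\<close>. It therefore
  suffices to find a polynomial \<open>f(y)\<close> with \<open>t + 1\<close> terms and \<open>2 t - 1\<close> distinct roots that are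
  nonzero \<open>N\<close>-th powers, and to substitute \<open>y = x\<^sup>N\<close>.

  Such an \<open>f\<close> is built from \<open>y - 1\<close> by adding one term at a time, each bringing two new roots. Simple roots
  survive small perturbations of the coefficients, and nonzero \<open>N\<close>-th powers form an open set, so the
  old roots are not lost if the new term and all corrections are small on a ball that contains
  them (\<open>simple_root_stable\<close>, \<open>simple_power_roots_stable\<close>). The new roots are placed far outside this ball.

  Let \<open>a y\<^sup>d + b y\<^sup>e\<close> be the two leading terms of \<open>f\<close>. With a new term \<open>c y\<^sup>n\<close>, where \<open>n = d + m\<close>,
  and a change of \<open>a\<close>, one can force a double root at any nonzero point \<open>R\<close>. For large \<open>R\<close> and small \<open>m\<close>
  the change of \<open>a\<close> is small if \<open>m R\<^sup>d\<^sup>-\<^sup>e\<close> is close to \<open>- (d - e) b / a\<close>. Over the real numbers a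
  positive integer \<open>m\<close> and a large \<open>R\<close> cannot achieve this, but \<open>p\<close>-adically
  they can: a highly divisible \<open>m\<close> is small. This is \<open>double_root_by_new_term\<close>. It
  needs \<open>b / a\<close> to be rational, and therefore all coefficients are kept rational. A last tiny
  perturbation splits the double root into two simple ones (\<open>two_new_roots\<close>).

  Apart from the chosen points \<open>R\<close>, the roots are found by Newton's method, so \<open>K\<close> must be complete; this follows from the completeness
  of \<open>Q\<^sub>p\<close> by adjoining one vector of a spanning set at a time (\<open>cauchy_complete_adjoin\<close>).
\<close>

section \<open>Non-archimedean absolute values and completeness\<close>

text \<open>
  Completeness is relative to a set, since it passes
  from \<open>Q\<^sub>p\<close> to its finite extension through intermediate subspaces.
\<close>
definition cauchy_complete :: "('a::ab_group_add \<Rightarrow> real) \<Rightarrow> 'a set \<Rightarrow> bool" where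
  "cauchy_complete v S \<longleftrightarrow>
     (\<forall>\<sigma> :: nat \<Rightarrow> 'a. range \<sigma> \<subseteq> S \<and> (\<forall>e>0. \<exists>N. \<forall>m\<ge>N. \<forall>n\<ge>N. v (\<sigma> m - \<sigma> n) < e) \<longrightarrow>
        (\<exists>l\<in>S. (\<lambda>n. v (\<sigma> n - l)) \<longlonglongrightarrow> 0))"

definition span_over :: "'a::comm_ring_1 set \<Rightarrow> 'a set \<Rightarrow> 'a set" where
  "span_over F B = {x. \<exists>c. (\<forall>b\<in>B. c b \<in> F) \<and> x = (\<Sum>b\<in>B. c b * b)}"

lemma span_overI: "x = (\<Sum>b\<in>B. c b * b) \<Longrightarrow> \<forall>b\<in>B. c b \<in> F \<Longrightarrow> x \<in> span_over F B"
  unfolding span_over_def mem_Collect_eq by (rule exI[of _ c]) simp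

lemma span_overE:
  assumes "x \<in> span_over F B"
  obtains c where "x = (\<Sum>b\<in>B. c b * b)" "\<forall>b\<in>B. c b \<in> F"
  using assms unfolding span_over_def mem_Collect_eq by (elim exE conjE)

lemma cauchy_completeD:
  assumes "cauchy_complete v S" and "\<And>n. \<sigma> n \<in> S"
    and "\<And>e. e > 0 \<Longrightarrow> \<exists>N. \<forall>m\<ge>N. \<forall>n\<ge>N. v (\<sigma> m - \<sigma> n) < e"
  obtains l where "l \<in> S" "(\<lambda>n. v (\<sigma> n - l)) \<longlonglongrightarrow> 0"
proof -
  have "range \<sigma> \<subseteq> S \<and> (\<forall>e>0. \<exists>N. \<forall>m\<ge>N. \<forall>n\<ge>N. v (\<sigma> m - \<sigma> n) < e)"
    using assms(2,3) by auto
  with assms(1) have "\<exists>l\<in>S. (\<lambda>n. v (\<sigma> n - l)) \<longlonglongrightarrow> 0"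
    unfolding cauchy_complete_def by (elim allE) (erule mp)
  then show ?thesis using that by blast
qed

locale nonarch_valued_field =
  fixes v :: "'a::field \<Rightarrow> real"
  assumes nonarch: "nonarch_abs v"
begin

lemma v_nonneg [simp]: "v x \<ge> 0"
  and v_eq_0_iff [simp]: "v x = 0 \<longleftrightarrow> x = 0"
  and v_mult: "v (x * y) = v x * v y"
  and v_add_le_max: "v (x + y) \<le> max (v x) (v y)"
  using nonarch unfolding nonarch_abs_def by blast+

lemma v_0 [simp]: "v 0 = 0"
  by simp

lemma v_pos_iff [simp]: "v x > 0 \<longleftrightarrow> x \<noteq> 0"
  using v_nonneg[of x] v_eq_0_iff[of x] by linarith

lemma v_1 [simp]: "v 1 = 1"
  using v_mult[of 1 1] v_eq_0_iff[of 1] by simp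

lemma v_minus [simp]: "v (- x) = v x"
proof -
  have "v (-1) * v (-1) = 1"
    using v_mult[of "-1" "-1"] by simp
  then have "v (-1) = 1"
    using v_nonneg[of "-1"] by (simp add: square_eq_1_iff)
  then show ?thesis
    using v_mult[of "-1" x] by simp
qed

lemma v_diff_commute: "v (x - y) = v (y - x)"
  using v_minus[of "x - y"] by simp

lemma v_add_le: "v x \<le> c \<Longrightarrow> v y \<le> c \<Longrightarrow> v (x + y) \<le> c"
  using v_add_le_max[of x y] by linarith

lemma v_add_less: "v x < c \<Longrightarrow> v y < c \<Longrightarrow> v (x + y) < c"
  using v_add_le_max[of x y] by linarith

lemma v_diff_le: "v x \<le> c \<Longrightarrow> v y \<le> c \<Longrightarrow> v (x - y) \<le> c"
  using v_add_le[of x c "- y"] by simp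

lemma v_diff_less: "v x < c \<Longrightarrow> v y < c \<Longrightarrow> v (x - y) < c"
  using v_add_less[of x c "- y"] by simp

lemma v_triangle_less: "v (x - y) < c \<Longrightarrow> v (y - z) < c \<Longrightarrow> v (x - z) < c"
  using v_add_less[of "x - y" c "y - z"] by simp

lemma v_triangle_le: "v (x - y) \<le> c \<Longrightarrow> v (y - z) \<le> c \<Longrightarrow> v (x - z) \<le> c"
  using v_add_le[of "x - y" c "y - z"] by simp

lemma v_add_dominant: "v y < v x \<Longrightarrow> v (x + y) = v x"
  using v_add_le_max[of x y] v_diff_le[of "x + y" "max (v (x + y)) (v y)" y] by auto

lemma v_eq_of_close: "v (x - y) < v y \<Longrightarrow> v x = v y"
  using v_add_dominant[of "x - y" y] by simp

lemma v_power: "v (x ^ n) = v x ^ n"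
  by (induction n) (auto simp: v_mult)

lemma v_inverse: "v (inverse x) = inverse (v x)"
  using v_mult[of x "inverse x"] by (cases "x = 0") (auto simp: field_simps)

lemma v_divide: "v (x / y) = v x / v y"
  by (simp add: divide_inverse v_mult v_inverse)

lemma v_of_nat_le_1: "v (of_nat n) \<le> 1"
  by (induction n) (auto intro: v_add_le)

lemma v_of_int_le_1: "v (of_int k) \<le> 1"
  using v_of_nat_le_1 by (cases k) (simp_all del: of_nat_Suc)

lemma v_sum_less: "c > 0 \<Longrightarrow> (\<And>i. i \<in> S \<Longrightarrow> v (f i) < c) \<Longrightarrow> v (sum f S) < c"
  by (induction S rule: infinite_finite_induct) (auto intro: v_add_less)

lemma v_prod_diff_less_1:
  assumes "finite S" and "\<And>i. i \<in> S \<Longrightarrow> v (f i) \<le> 1" and "\<And>i. i \<in> S \<Longrightarrow> v (g i) \<le> 1"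
    and "\<And>i. i \<in> S \<Longrightarrow> v (f i - g i) < 1"
  shows "v (prod f S - prod g S) < 1"
  using assms
proof (induction S rule: finite_induct)
  case empty
  then show ?case by simp
next
  case (insert i S)
  have "prod (\<lambda>i. v (g i)) S \<le> 1"
    using insert.prems(2) by (intro prod_le_1) auto
  moreover have "v (prod g T) = prod (\<lambda>i. v (g i)) T" for T
    by (induction T rule: infinite_finite_induct) (auto simp: v_mult)
  ultimately have "v (prod g S) \<le> 1" by simp
  then have "v (f i * (prod f S - prod g S)) < 1" "v ((f i - g i) * prod g S) < 1"
    using insert.IH insert.prems
      mult_left_le_one_le[of "v (prod f S - prod g S)" "v (f i)"]
      mult_right_le_one_le[of "v (f i - g i)" "v (prod g S)"]
    by (auto simp: v_mult intro: le_less_trans)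
  from v_add_less[OF this] show ?case
    using insert.hyps by (simp add: algebra_simps)
qed

text \<open>
  A complete subspace is closed, so a vector \<open>b\<close> outside it has positive distance from it.
  Therefore \<open>v (x + c * b)\<close> bounds \<open>v c\<close> up to a constant, and the coordinates of a Cauchy sequence
  are Cauchy.
\<close>
lemma cauchy_complete_adjoin:
  assumes F: "is_subfield F" and cF: "cauchy_complete v F"
    and V: "\<And>x y. x \<in> V \<Longrightarrow> y \<in> V \<Longrightarrow> x - y \<in> V" "\<And>x c. x \<in> V \<Longrightarrow> c \<in> F \<Longrightarrow> c * x \<in> V"
    and cV: "cauchy_complete v V"
  shows "cauchy_complete v {x + c * b | x c. x \<in> V \<and> c \<in> F}" (is "cauchy_complete v ?W")
proof (cases "b \<in> V \<or> V = {}")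
  case True
  have "?W = V"
  proof (cases "V = {}")
    case False
    then have "b \<in> V" using True by simp
    have z: "0 \<in> V" using V(1)[OF \<open>b \<in> V\<close> \<open>b \<in> V\<close>] by simp
    have neg: "- y \<in> V" if "y \<in> V" for y using V(1)[OF z that] by simp
    have add: "x + y \<in> V" if "x \<in> V" "y \<in> V" for x y
      using V(1)[OF that(1) neg[OF that(2)]] by simp
    have zF: "0 \<in> F" using F unfolding is_subfield_def by (metis diff_self)
    show ?thesis
    proof (intro equalityI subsetI)
      fix w assume "w \<in> ?W"
      then show "w \<in> V" using add V(2) \<open>b \<in> V\<close> by auto
    next
      fix w assume "w \<in> V"
      then have "w = w + 0 * b \<and> w \<in> V \<and> 0 \<in> F" using zF by simp
      then show "w \<in> ?W" by blast
    qed
  qed auto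
  then show ?thesis using cV by simp
next
  case False
  then have bV: "b \<notin> V" and "V \<noteq> {}" by auto
  then obtain x0 where x0: "x0 \<in> V" by auto
  have z: "0 \<in> V" using V(1)[OF x0 x0] by simp
  have neg: "- y \<in> V" if "y \<in> V" for y using V(1)[OF z that] by simp
  have Fd: "c - d \<in> F" "c * d \<in> F" "inverse c \<in> F" if "c \<in> F" "d \<in> F" for c d
    using F that unfolding is_subfield_def by auto
  (* Otherwise - b is a limit of elements of V, hence in V by completeness. *)
  have "\<exists>\<delta>>0. \<forall>x\<in>V. v (x + b) \<ge> \<delta>"
  proof (rule ccontr)
    assume "\<not> ?thesis"
    then have *: "\<And>\<delta>. \<delta> > 0 \<Longrightarrow> \<exists>x\<in>V. v (x + b) < \<delta>" by force
    have "\<forall>n. \<exists>x\<in>V. v (x + b) < inverse (real (Suc n))" by (intro allI *) auto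
    then obtain \<sigma> where \<sigma>: "\<And>n. \<sigma> n \<in> V" "\<And>n. v (\<sigma> n + b) < inverse (real (Suc n))"
      by metis
    have "\<exists>N. \<forall>m\<ge>N. \<forall>n\<ge>N. v (\<sigma> m - \<sigma> n) < e" if e: "e > 0" for e
    proof -
      obtain N where N: "inverse (real (Suc N)) < e" using reals_Archimedean[OF e] by auto
      have "v (\<sigma> n + b) < e" if "n \<ge> N" for n
        using \<sigma>(2)[of n] N that by (smt (verit) inverse_le_iff_le of_nat_0_less_iff of_nat_le_iff
            Suc_le_mono zero_less_Suc)
      then have "v ((\<sigma> m + b) - (\<sigma> n + b)) < e" if "m \<ge> N" "n \<ge> N" for m n
        using that by (intro v_diff_less) auto
      then show ?thesis by auto
    qed
    then obtain l where l: "l \<in> V" "(\<lambda>n. v (\<sigma> n - l)) \<longlonglongrightarrow> 0"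
      using cauchy_completeD[OF cV, of \<sigma>] \<sigma>(1) by blast
    have "(\<lambda>n. max (inverse (real (Suc n))) (v (\<sigma> n - l))) \<longlonglongrightarrow> max 0 0"
      by (intro tendsto_max l(2) LIMSEQ_inverse_real_of_nat)
    moreover have "v (l + b) \<le> max (inverse (real (Suc n))) (v (\<sigma> n - l))" for n
      using v_diff_le[of "\<sigma> n + b" "max (inverse (real (Suc n))) (v (\<sigma> n - l))" "\<sigma> n - l"] \<sigma>(2)[of n]
      by (simp add: add.commute del: of_nat_Suc)
    ultimately have "v (l + b) \<le> max 0 0"
      by (intro LIMSEQ_le_const) auto
    then have "v (l + b) = 0" using v_nonneg[of "l + b"] by simp
    then have "b = - l" by (simp add: eq_neg_iff_add_eq_0 add.commute)
    then show False using neg[OF l(1)] bV by simp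
  qed
  then obtain \<delta> where \<delta>: "\<delta> > 0" "\<And>x. x \<in> V \<Longrightarrow> v (x + b) \<ge> \<delta>" by blast
  have coord: "v c * \<delta> \<le> v (x + c * b)" if "x \<in> V" "c \<in> F" for x c
  proof (cases "c = 0")
    case False
    have "\<delta> \<le> v (inverse c * x + b)"
      using that V(2) Fd(3) by (intro \<delta>) blast
    then have "v c * \<delta> \<le> v c * v (inverse c * x + b)" by (intro mult_left_mono) auto
    also have "\<dots> = v (x + c * b)" 
      using False by (simp add: v_mult[symmetric] distrib_left mult.assoc[symmetric])
    finally show ?thesis .
  qed auto
  show ?thesis
    unfolding cauchy_complete_def
  proof (intro allI impI, elim conjE)
    fix \<sigma> :: "nat \<Rightarrow> 'a" assume r: "range \<sigma> \<subseteq> ?W" and C: "\<forall>e>0. \<exists>N. \<forall>m\<ge>N. \<forall>n\<ge>N. v (\<sigma> m - \<sigma> n) < e"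
    have "\<forall>n. \<exists>x c. \<sigma> n = x + c * b \<and> x \<in> V \<and> c \<in> F" using r by blast
    then obtain x where "\<forall>n. \<exists>c. \<sigma> n = x n + c * b \<and> x n \<in> V \<and> c \<in> F"
      by (rule choice[THEN exE])
    then obtain c where "\<forall>n. \<sigma> n = x n + c n * b \<and> x n \<in> V \<and> c n \<in> F"
      by (rule choice[THEN exE])
    then have xc: "\<And>n. \<sigma> n = x n + c n * b" "\<And>n. x n \<in> V" "\<And>n. c n \<in> F"
      by blast+
    have "\<exists>N. \<forall>m\<ge>N. \<forall>n\<ge>N. v (c m - c n) < e" if "e > 0" for e
    proof -
      obtain N where N: "\<And>m n. m \<ge> N \<Longrightarrow> n \<ge> N \<Longrightarrow> v (\<sigma> m - \<sigma> n) < e * \<delta>"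
        using C \<open>e > 0\<close> \<delta>(1) by (meson mult_pos_pos)
      have "v (c m - c n) < e" if "m \<ge> N" "n \<ge> N" for m n
      proof -
        have "v (c m - c n) * \<delta> \<le> v ((x m - x n) + (c m - c n) * b)"
          using xc V Fd by (intro coord) auto
        also have "(x m - x n) + (c m - c n) * b = \<sigma> m - \<sigma> n" by (simp add: xc algebra_simps)
        also have "v (\<sigma> m - \<sigma> n) < e * \<delta>" using N that by simp
        finally show ?thesis using \<delta>(1) by simp
      qed
      then show ?thesis by blast
    qed
    then obtain cl where cl: "cl \<in> F" "(\<lambda>n. v (c n - cl)) \<longlonglongrightarrow> 0"
      using cauchy_completeD[OF cF, of c] xc(3) by blast
    then have clb: "(\<lambda>n. v (c n - cl) * v b) \<longlonglongrightarrow> 0" using tendsto_mult_left_zero by blast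
    have "\<exists>N. \<forall>m\<ge>N. \<forall>n\<ge>N. v (x m - x n) < e" if "e > 0" for e
    proof -
      obtain N where N: "\<And>m n. m \<ge> N \<Longrightarrow> n \<ge> N \<Longrightarrow> v (\<sigma> m - \<sigma> n) < e"
        using C \<open>e > 0\<close> by meson
      obtain N' where N': "\<And>n. n \<ge> N' \<Longrightarrow> v ((c n - cl) * b) < e"
        using order_tendstoD(2)[OF clb \<open>e > 0\<close>] by (auto simp: eventually_sequentially v_mult)
      have "v (x m - x n) < e" if "m \<ge> max N N'" "n \<ge> max N N'" for m n
      proof -
        have "v (((c m - cl) * b) - ((c n - cl) * b)) < e"
          using that by (intro v_diff_less N') auto
        with N[of m n] that have "v ((\<sigma> m - \<sigma> n) - (((c m - cl) * b) - ((c n - cl) * b))) < e"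
          by (intro v_diff_less[of "\<sigma> m - \<sigma> n"]) auto
        then show ?thesis by (simp add: xc algebra_simps)
      qed
      then show ?thesis by blast
    qed
    then obtain xl where xl: "xl \<in> V" "(\<lambda>n. v (x n - xl)) \<longlonglongrightarrow> 0"
      using cauchy_completeD[OF cV, of x] xc(2) by blast
    have "(\<lambda>n. v (\<sigma> n - (xl + cl * b))) \<longlonglongrightarrow> 0"
    proof (rule tendsto_sandwich[OF _ _ tendsto_const])
      show "(\<lambda>n. max (v (x n - xl)) (v (c n - cl) * v b)) \<longlonglongrightarrow> 0"
        using tendsto_max[OF xl(2) clb] by simp
      show "\<forall>\<^sub>F n in sequentially. v (\<sigma> n - (xl + cl * b)) \<le> max (v (x n - xl)) (v (c n - cl) * v b)"
      proof (rule always_eventually, rule allI)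
        fix n
        have "\<sigma> n - (xl + cl * b) = (x n - xl) + (c n - cl) * b" by (simp add: xc algebra_simps)
        then show "v (\<sigma> n - (xl + cl * b)) \<le> max (v (x n - xl)) (v (c n - cl) * v b)"
          using v_add_le_max[of "x n - xl" "(c n - cl) * b"] by (simp only: v_mult)
      qed
    qed auto
    then show "\<exists>l\<in>?W. (\<lambda>n. v (\<sigma> n - l)) \<longlonglongrightarrow> 0" using xl(1) cl(1) by blast
  qed
qed

lemma cauchy_complete_span:
  assumes F: "is_subfield F" "cauchy_complete v F" and "finite B"
  shows "cauchy_complete v (span_over F B)"
  using \<open>finite B\<close>
proof (induction B rule: finite_induct)
  case empty
  then show ?case
    by (simp add: cauchy_complete_def image_subset_iff span_over_def)
next
  case (insert b B)
  have "x - y \<in> span_over F B" if xy: "x \<in> span_over F B" "y \<in> span_over F B" for x y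
  proof -
    obtain c where "x = (\<Sum>b\<in>B. c b * b)" "\<forall>b\<in>B. c b \<in> F" by (rule span_overE[OF xy(1)])
    moreover obtain c' where "y = (\<Sum>b\<in>B. c' b * b)" "\<forall>b\<in>B. c' b \<in> F" by (rule span_overE[OF xy(2)])
    ultimately have "x - y = (\<Sum>b\<in>B. (c b - c' b) * b)" "\<forall>b\<in>B. c b - c' b \<in> F"
      using F(1) by (auto simp: is_subfield_def sum_subtractf left_diff_distrib)
    then show ?thesis by (rule span_overI)
  qed
  moreover have "d * x \<in> span_over F B" if xd: "x \<in> span_over F B" "d \<in> F" for x d
  proof -
    obtain c where "x = (\<Sum>b\<in>B. c b * b)" "\<forall>b\<in>B. c b \<in> F" by (rule span_overE[OF xd(1)])
    then have "d * x = (\<Sum>b\<in>B. (d * c b) * b)" "\<forall>b\<in>B. d * c b \<in> F"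
      using F(1) xd by (auto simp: is_subfield_def sum_distrib_left mult.assoc)
    then show ?thesis by (rule span_overI)
  qed
  ultimately have "cauchy_complete v {x + c * b | x c. x \<in> span_over F B \<and> c \<in> F}"
    using F insert.IH by (intro cauchy_complete_adjoin) auto
  also have "{x + c * b | x c. x \<in> span_over F B \<and> c \<in> F} = span_over F (insert b B)"
  proof (intro equalityI subsetI)
    fix w assume "w \<in> {x + c * b | x c. x \<in> span_over F B \<and> c \<in> F}"
    then obtain x d where x: "x \<in> span_over F B" and d: "w = x + d * b" "d \<in> F"
      unfolding mem_Collect_eq by (elim exE conjE)
    obtain c where c: "x = (\<Sum>b\<in>B. c b * b)" "\<forall>b\<in>B. c b \<in> F" by (rule span_overE[OF x])
    have "(\<Sum>b'\<in>B. (c(b := d)) b' * b') = (\<Sum>b'\<in>B. c b' * b')"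
    proof (intro sum.cong refl)
      fix b' assume "b' \<in> B"
      with insert.hyps(2) have "b' \<noteq> b" by blast
      then show "(c(b := d)) b' * b' = c b' * b'" by simp
    qed
    then have "w = (\<Sum>b'\<in>insert b B. (c(b := d)) b' * b')"
      using insert.hyps c(1) d(1) by (simp add: add.commute)
    moreover have "\<forall>b'\<in>insert b B. (c(b := d)) b' \<in> F"
      using c(2) d(2) by simp
    ultimately show "w \<in> span_over F (insert b B)" by (rule span_overI)
  next
    fix w assume w: "w \<in> span_over F (insert b B)"
    obtain c where c: "w = (\<Sum>b\<in>insert b B. c b * b)" "\<forall>b\<in>insert b B. c b \<in> F"
      by (rule span_overE[OF w])
    have "(\<Sum>b\<in>B. c b * b) \<in> span_over F B" using c(2) by (intro span_overI) auto
    moreover have "w = (\<Sum>b\<in>B. c b * b) + c b * b" "c b \<in> F"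
      using c insert.hyps by (simp_all add: add.commute)
    ultimately show "w \<in> {x + c * b | x c. x \<in> span_over F B \<and> c \<in> F}"
      by (intro CollectI exI conjI)
  qed
  finally show ?case .
qed

lemma Metric_space_v: "Metric_space S (\<lambda>x y. v (x - y))"
proof
  show "v (x - z) \<le> v (x - y) + v (y - z)" for x y z
    using v_add_le_max[of "x - y" "y - z"] v_nonneg[of "x - y"] v_nonneg[of "y - z"]
    by (simp add: max_def del: v_nonneg split: if_splits)
  show "v (x - y) = v (y - x)" for x y by (rule v_diff_commute)
qed simp_all

lemma cauchy_complete_if_mcomplete:
  assumes "Metric_space.mcomplete S (\<lambda>x y. v (x - y))"
  shows "cauchy_complete v S"
proof -
  interpret Metric_space S "\<lambda>x y. v (x - y)" by (rule Metric_space_v)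
  show ?thesis
    unfolding cauchy_complete_def
  proof (intro allI impI, elim conjE)
    fix \<sigma> :: "nat \<Rightarrow> 'a" assume "range \<sigma> \<subseteq> S" "\<forall>e>0. \<exists>N. \<forall>m\<ge>N. \<forall>n\<ge>N. v (\<sigma> m - \<sigma> n) < e"
    then have "MCauchy \<sigma>"
      unfolding MCauchy_def by meson
    then have "\<exists>l. limitin mtopology \<sigma> l sequentially"
      by (rule assms[unfolded mcomplete_def, rule_format])
    then obtain l where l: "limitin mtopology \<sigma> l sequentially" ..
    then have "(\<lambda>n. v (\<sigma> n - l)) \<longlonglongrightarrow> 0"
      using limitin_metric_dist_null[of \<sigma> l sequentially] by simp
    moreover have "l \<in> S" using limitin_mspace[OF l] .
    ultimately show "\<exists>l\<in>S. (\<lambda>n. v (\<sigma> n - l)) \<longlonglongrightarrow> 0" by blast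
  qed
qed

lemma finite_extension_complete:
  assumes "is_subfield F" "Metric_space.mcomplete F (\<lambda>x y. v (x - y))" "finite_extension_of F"
  shows "cauchy_complete v UNIV"
proof -
  obtain B where B: "finite B" "\<forall>x. \<exists>c. (\<forall>b\<in>B. c b \<in> F) \<and> x = (\<Sum>b\<in>B. c b * b)"
    using assms(3) unfolding finite_extension_of_def by (elim exE conjE)
  have "cauchy_complete v (span_over F B)"
    using assms B(1) by (intro cauchy_complete_span cauchy_complete_if_mcomplete)
  also have "span_over F B = UNIV"
    unfolding span_over_def using B(2) by simp
  finally show ?thesis .
qed

end

section \<open>Newton's method and the stability of simple roots\<close>

context nonarch_valued_field
begin

lemma v_poly_le:
  assumes "\<And>i. v (coeff P i) \<le> M" and "v z \<le> 1"
  shows "v (poly P z) \<le> M"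
  using assms(1)
proof (induction P)
  case 0
  then show ?case using v_nonneg order_trans by fastforce
next
  case (pCons a P)
  have "v (coeff P i) \<le> M" for i using pCons.prems[of "Suc i"] by simp
  then have "v (poly P z) \<le> M" by (rule pCons.IH)
  then have "v (z * poly P z) \<le> M"
    using mult_left_le_one_le[of "v (poly P z)" "v z"] assms(2) by (simp add: v_mult)
  then show ?case using pCons.prems[of 0] by (simp add: v_add_le)
qed

lemma v_poly_diff_le:
  assumes "\<And>i. v (coeff P i) \<le> M" and "v z \<le> 1" "v w \<le> 1"
  shows "v (poly P z - poly P w) \<le> M * v (z - w)"
  using assms(1)
proof (induction P)
  case 0
  have "0 \<le> M" using order_trans[OF v_nonneg "0"[of 0]] .
  then show ?case by (auto intro: mult_nonneg_nonneg)
next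
  case (pCons a P)
  have c: "v (coeff P i) \<le> M" for i using pCons.prems[of "Suc i"] by simp
  then have "v (z * (poly P z - poly P w)) \<le> M * v (z - w)"
    unfolding v_mult
    using mult_left_le_one_le[of "v (poly P z - poly P w)" "v z"] assms(2) pCons.IH
    by (meson order_trans v_nonneg)
  moreover have "v ((z - w) * poly P w) \<le> M * v (z - w)"
    using mult_right_mono[OF v_poly_le[OF c assms(3)] v_nonneg[of "z - w"]]
    by (simp add: v_mult mult.commute)
  ultimately have "v (z * (poly P z - poly P w) + (z - w) * poly P w) \<le> M * v (z - w)"
    by (rule v_add_le)
  moreover have "poly (pCons a P) z - poly (pCons a P) w = z * (poly P z - poly P w) + (z - w) * poly P w"
    by (simp add: algebra_simps)
  ultimately show ?case by (simp only:)
qed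

text \<open>
  Expanding \<open>(x + a)\<^sup>i\<close> produces powers of \<open>a\<close> of size at most \<open>A\<^sup>i\<close>, and integer factors, which have
  absolute value at most \<open>1\<close>. The weights \<open>A\<^sup>i\<close> absorb the former uniformly in the degree.
  This uniformity allows perturbing a polynomial by terms whose degree is chosen only after \<open>\<delta>\<close>.
\<close>
lemma v_coeff_shift_le:
  assumes "\<And>i. v (coeff h i) * A ^ i \<le> \<delta>" and "v a \<le> A" "A \<ge> 1"
  shows "v (coeff (pcompose h [:a, 1:]) i) \<le> \<delta>"
  using assms(1)
proof (induction h arbitrary: \<delta> i)
  case 0
  then show ?case using "0"[of 0] by simp
next
  case (pCons c h)
  have \<delta>: "\<delta> \<ge> 0" "v c \<le> \<delta>"
    using pCons.prems[of 0] v_nonneg[of c] by (auto simp del: v_nonneg)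
  have "v (coeff h j) * A ^ j \<le> \<delta> / A" for j
    using pCons.prems[of "Suc j"] assms(3) by (simp add: field_simps)
  then have *: "v (coeff (pcompose h [:a, 1:]) j) \<le> \<delta> / A" for j by (rule pCons.IH)
  have **: "v (coeff (pcompose h [:a, 1:]) j) \<le> \<delta>" for j
  proof -
    have "\<delta> / A \<le> \<delta>" using mult_left_mono[of 1 A \<delta>] assms(3) \<delta>(1) by (simp add: divide_le_eq)
    with *[of j] show ?thesis by (rule order_trans)
  qed
  have "v (a * coeff (pcompose h [:a, 1:]) j) \<le> A * (\<delta> / A)" for j
    unfolding v_mult using * assms(2,3) by (intro mult_mono) auto
  then have ***: "v (a * coeff (pcompose h [:a, 1:]) j) \<le> \<delta>" for j using assms(3) by simp
  show ?case
  proof (cases i)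
    case 0
    then show ?thesis
      using v_add_le[OF \<delta>(2) ***[of 0]] by (simp add: pcompose_pCons coeff_mult_0)
  next
    case (Suc j)
    then show ?thesis
      using v_add_le[OF ***[of "Suc j"] **[of j]] by (simp add: pcompose_pCons)
  qed
qed

lemma coeff_1_shift: "coeff (pcompose h [:a, 1:]) 1 = poly (pderiv h) a"
proof -
  have "poly (pderiv (pcompose h [:a, 1:])) 0 = coeff (pcompose h [:a, 1:]) 1"
    by (simp add: poly_0_coeff_0 coeff_pderiv)
  then show ?thesis by (simp add: pderiv_pcompose poly_pcompose pderiv_pCons)
qed

lemma coeff_bound_exists:
  obtains M where "\<And>i. v (coeff h i) * A ^ i \<le> M"
proof -
  let ?M = "Max ((\<lambda>i. v (coeff h i) * A ^ i) ` {..Suc (degree h)})"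
  have "v (coeff h i) * A ^ i \<le> ?M" for i
  proof (cases "i \<le> degree h")
    case True
    then show ?thesis by (intro Max_ge) auto
  next
    case False
    then have "v (coeff h i) * A ^ i = v (coeff h (Suc (degree h))) * A ^ Suc (degree h)"
      by (simp add: coeff_eq_0)
    also have "\<dots> \<le> ?M" by (rule Max_ge[OF finite_imageI imageI]) simp_all
    finally show ?thesis .
  qed
  then show ?thesis by (rule that)
qed

end

locale complete_valued_field = nonarch_valued_field v for v :: "'a::field_char_0 \<Rightarrow> real" +
  assumes complete: "cauchy_complete v UNIV"
begin

lemma contraction_fixpoint:
  assumes r: "0 \<le> r" and \<kappa>: "0 \<le> \<kappa>" "\<kappa> < 1"
    and maps: "\<And>z. v z \<le> r \<Longrightarrow> v (T z) \<le> r"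
    and contr: "\<And>z w. v z \<le> r \<Longrightarrow> v w \<le> r \<Longrightarrow> v (T z - T w) \<le> \<kappa> * v (z - w)"
  obtains z where "v z \<le> r" and "T z = z"
proof -
  define \<sigma> where "\<sigma> n = (T ^^ n) 0" for n
  have \<sigma>_Suc: "\<sigma> (Suc n) = T (\<sigma> n)" for n by (simp add: \<sigma>_def)
  have \<sigma>_r: "v (\<sigma> n) \<le> r" for n by (induction n) (auto simp: \<sigma>_Suc maps, simp add: \<sigma>_def r)
  have step: "v (\<sigma> (n + k) - \<sigma> n) \<le> \<kappa> ^ n * r" for n k
  proof (induction n)
    case 0
    then show ?case using \<sigma>_r[of k] by (simp add: \<sigma>_def)
  next
    case (Suc n)
    have "v (\<sigma> (Suc n + k) - \<sigma> (Suc n)) \<le> \<kappa> * v (\<sigma> (n + k) - \<sigma> n)"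
      using contr[OF \<sigma>_r \<sigma>_r] by (simp add: \<sigma>_Suc)
    also have "\<dots> \<le> \<kappa> * (\<kappa> ^ n * r)" by (intro mult_left_mono Suc \<kappa>)
    finally show ?case by (simp add: mult.assoc)
  qed
  have lim0: "(\<lambda>n. \<kappa> ^ n * r) \<longlonglongrightarrow> 0"
    using \<kappa> by (intro tendsto_mult_left_zero LIMSEQ_power_zero) auto
  have "\<exists>N. \<forall>m\<ge>N. \<forall>n\<ge>N. v (\<sigma> m - \<sigma> n) < e" if "e > 0" for e
  proof -
    obtain N where N: "\<kappa> ^ N * r < e"
      using order_tendstoD(2)[OF lim0 \<open>e > 0\<close>] by (auto simp: eventually_sequentially)
    have "v (\<sigma> m - \<sigma> N) < e" if "m \<ge> N" for m
      using step[of N "m - N"] that N by simp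
    then have "v ((\<sigma> m - \<sigma> N) - (\<sigma> n - \<sigma> N)) < e" if "m \<ge> N" "n \<ge> N" for m n
      using that by (intro v_diff_less[of "\<sigma> m - \<sigma> N"])
    then show ?thesis by auto
  qed
  then obtain l where l: "(\<lambda>n. v (\<sigma> n - l)) \<longlonglongrightarrow> 0"
    using cauchy_completeD[OF complete, of \<sigma>] by blast
  have "(\<lambda>n. max r (v (\<sigma> n - l))) \<longlonglongrightarrow> max r 0" by (intro tendsto_max l tendsto_const)
  moreover have "v l \<le> max r (v (\<sigma> n - l))" for n
    using v_diff_le[of "\<sigma> n" "max r (v (\<sigma> n - l))" "\<sigma> n - l"] \<sigma>_r[of n] by auto
  ultimately have "v l \<le> max r 0" by (intro LIMSEQ_le_const) auto
  then have lr: "v l \<le> r" using r by simp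
  have "(\<lambda>n. max (\<kappa> * v (\<sigma> n - l)) (v (\<sigma> (Suc n) - l))) \<longlonglongrightarrow> max 0 0"
    by (intro tendsto_max tendsto_mult_right_zero l LIMSEQ_Suc[OF l])
  moreover have "v (T l - l) \<le> max (\<kappa> * v (\<sigma> n - l)) (v (\<sigma> (Suc n) - l))" for n
  proof -
    have "v (T l - T (\<sigma> n)) \<le> \<kappa> * v (\<sigma> n - l)"
      using contr[OF lr \<sigma>_r, of n] by (simp add: v_diff_commute)
    then show ?thesis
      by (intro v_triangle_le[of "T l" "T (\<sigma> n)" _ l]) (auto simp: \<sigma>_Suc)
  qed
  ultimately have "v (T l - l) \<le> max 0 0" by (intro LIMSEQ_le_const) auto
  then have "T l = l" using v_nonneg[of "T l - l"] by (simp del: v_nonneg)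
  with lr show ?thesis by (rule that)
qed

text \<open>
  For a polynomial \<open>c\<^sub>0 + c\<^sub>1 x + x\<^sup>2 H(x)\<close> that is nearly linear on the ball of radius \<open>r\<close>, the map
  \<open>x \<mapsto> - (c\<^sub>0 + x\<^sup>2 H(x)) / c\<^sub>1\<close> is a contraction of this ball, and its fixed points are the roots.
\<close>
lemma root_of_nearly_linear:
  assumes H: "\<And>i. v (coeff H i) \<le> M" and r: "0 \<le> r" "r \<le> 1"
    and c: "v c0 \<le> r * v c1" "M * r < v c1"
  obtains z where "v z \<le> r" "poly (pCons c0 (pCons c1 H)) z = 0"
    and "poly (pderiv (pCons c0 (pCons c1 H))) z \<noteq> 0"
proof -
  have M: "M \<ge> 0" using H[of 0] v_nonneg order_trans by blast
  have vc1: "v c1 > 0" using c M r by (smt (verit) mult_nonneg_nonneg)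
  then have c1: "c1 \<noteq> 0" by simp
  define T where "T z = - (c0 + z\<^sup>2 * poly H z) / c1" for z
  have sq: "v (z\<^sup>2 * poly H z) \<le> r * v c1" if z: "v z \<le> r" for z
  proof -
    have "v z * v (poly H z) \<le> r * M"
      using z r M by (intro mult_mono v_poly_le H) auto
    then have "v z * (v z * v (poly H z)) \<le> r * v c1"
      using z r c(2) by (intro mult_mono) (auto simp: mult.commute)
    then show ?thesis by (simp add: v_mult power2_eq_square mult.assoc)
  qed
  have maps: "v (T z) \<le> r" if "v z \<le> r" for z
    using v_add_le[OF c(1) sq[OF that]] vc1
    by (simp add: T_def v_divide divide_le_eq del: minus_add_distrib)
  have contr: "v (T z - T w) \<le> M * r / v c1 * v (z - w)" if z: "v z \<le> r" and w: "v w \<le> r" for z w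
  proof -
    have "T z - T w = - (z\<^sup>2 * (poly H z - poly H w) + (z - w) * (z + w) * poly H w) / c1"
      using c1 by (simp add: T_def field_simps power2_eq_square)
    moreover have "v (z\<^sup>2 * (poly H z - poly H w)) \<le> M * r * v (z - w)"
    proof -
      have "v z * v z \<le> r * 1" using z r by (intro mult_mono) auto
      then have "v z * v z * v (poly H z - poly H w) \<le> r * (M * v (z - w))"
        using z w r M by (intro mult_mono v_poly_diff_le H) auto
      then show ?thesis by (simp add: v_mult power2_eq_square mult_ac)
    qed
    moreover have "v ((z - w) * (z + w) * poly H w) \<le> M * r * v (z - w)"
    proof -
      have "v (z + w) * v (poly H w) \<le> r * M"
        using z w r by (intro mult_mono v_poly_le v_add_le H) auto
      then have "v (z - w) * (v (z + w) * v (poly H w)) \<le> v (z - w) * (r * M)"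
        by (intro mult_left_mono) auto
      then show ?thesis by (simp add: v_mult mult_ac)
    qed
    ultimately have "v (T z - T w) \<le> M * r * v (z - w) / v c1"
      using v_add_le[of "z\<^sup>2 * (poly H z - poly H w)" _ "(z - w) * (z + w) * poly H w"] vc1
      by (simp add: v_divide divide_right_mono del: minus_add_distrib)
    then show ?thesis by simp
  qed
  have \<kappa>: "0 \<le> M * r / v c1" "M * r / v c1 < 1"
    using r M c(2) vc1 by (simp_all add: divide_less_eq)
  have "\<exists>z. v z \<le> r \<and> T z = z"
    by (rule contraction_fixpoint[OF r(1) \<kappa>, of T]) (use maps contr in blast)+
  then obtain z where z: "v z \<le> r" "T z = z" by blast
  have "c0 + z * (c1 + z * poly H z) = c1 * (z - T z)"
    using c1 by (simp add: T_def power2_eq_square field_simps)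
  then have "poly (pCons c0 (pCons c1 H)) z = 0" using z by simp
  moreover have "poly (pderiv (pCons c0 (pCons c1 H))) z = c1 + z * (2 * poly H z + z * poly (pderiv H) z)"
    by (simp add: pderiv_pCons algebra_simps)
  moreover have "v (z * (2 * poly H z + z * poly (pderiv H) z)) \<le> r * M"
  proof -
    have "v (coeff (pderiv H) i) \<le> M" for i
      using H[of "Suc i"] mult_left_le_one_le[of "v (coeff H (Suc i))" "v (of_nat (Suc i))"] v_of_nat_le_1[of "Suc i"]
      by (simp add: coeff_pderiv v_mult del: of_nat_Suc)
    then have "v (poly (pderiv H) z) \<le> M" using z r by (intro v_poly_le) auto
    then have "v (z * poly (pderiv H) z) \<le> 1 * M"
      unfolding v_mult using z r by (intro mult_mono) auto
    moreover have "v (2 * poly H z) \<le> 1 * M"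
      unfolding v_mult using z r M v_of_nat_le_1[of 2] by (intro mult_mono v_poly_le H) auto
    ultimately have "v (2 * poly H z + z * poly (pderiv H) z) \<le> M" by (intro v_add_le) auto
    then show ?thesis unfolding v_mult using z r by (intro mult_mono) auto
  qed
  then have "v (z * (2 * poly H z + z * poly (pderiv H) z)) < v c1" using c(2) by (simp add: mult.commute)
  then have "v (c1 + z * (2 * poly H z + z * poly (pderiv H) z)) = v c1" by (rule v_add_dominant)
  ultimately show ?thesis using z vc1 that by (metis v_eq_0_iff less_irrefl)
qed

text \<open>
  The Taylor expansion at \<open>a\<close> reduces a root near \<open>a\<close> to a root near \<open>0\<close>. For \<open>M = 1\<close> and the
  smallest possible \<open>r\<close> this is Hensel's lemma.
\<close>
lemma simple_root_near:
  assumes "\<And>i. v (coeff (pcompose g [:a, 1:]) i) \<le> M" and r: "0 \<le> r" "r \<le> 1"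
    and c: "v (poly g a) \<le> r * v (poly (pderiv g) a)" "M * r < v (poly (pderiv g) a)"
  obtains b where "v (b - a) \<le> r" "poly g b = 0" "poly (pderiv g) b \<noteq> 0"
proof -
  let ?G = "pcompose g [:a, 1:]"
  obtain c0 c1 H where G: "?G = pCons c0 (pCons c1 H)" by (metis pCons_cases)
  have c0: "c0 = poly g a" using coeff_pcompose_0[of g "[:a, 1:]"] by (simp add: G)
  have c1: "c1 = poly (pderiv g) a" using coeff_1_shift[of g a] by (simp add: G)
  have "v (coeff H i) \<le> M" for i using assms(1)[of "Suc (Suc i)"] by (simp add: G)
  then obtain z where z: "v z \<le> r" "poly ?G z = 0" "poly (pderiv ?G) z \<noteq> 0"
    using root_of_nearly_linear[of H M r c0 c1] r c c0 c1 G by metis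
  show ?thesis
    using z by (intro that[of "a + z"]) (auto simp: poly_pcompose pderiv_pcompose pderiv_pCons)
qed

text \<open>
  A perturbation moves the value and the derivative at \<open>a\<close> by at most \<open>\<delta>\<close>. If \<open>\<delta>\<close> is small
  against the derivative, then Newton's method started at \<open>a\<close> still converges, within a radius that
  is fixed before the perturbation.
\<close>
lemma simple_root_stable:
  assumes a: "poly f a = 0" "poly (pderiv f) a \<noteq> 0" and A: "v a \<le> A" "A \<ge> 1" and "\<rho> > 0"
  obtains \<delta> where "\<delta> > 0" and "\<And>h. (\<And>i. v (coeff h i) * A ^ i \<le> \<delta>) \<Longrightarrow>
      \<exists>b. v (b - a) \<le> \<rho> \<and> poly (f + h) b = 0 \<and> poly (pderiv (f + h)) b \<noteq> 0"
proof -
  define D where "D = v (poly (pderiv f) a)"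
  have D: "D > 0" using a by (simp add: D_def)
  obtain M0 where M0: "\<And>i. v (coeff (pcompose f [:a, 1:]) i) * 1 ^ i \<le> M0"
    using coeff_bound_exists by blast
  define M where "M = max M0 D"
  (* On the ball of radius r the terms of degree at least 2 are dominated by the linear one. *)
  define r where "r = min (min 1 \<rho>) (D / (2 * M))"
  have M: "M > 0" "D \<le> M" "\<And>i. v (coeff (pcompose f [:a, 1:]) i) \<le> M"
    using D M0 by (auto simp: M_def le_max_iff_disj)
  have r: "0 < r" "r \<le> 1" "r \<le> \<rho>" "M * r < D"
  proof -
    have "M * r \<le> M * (D / (2 * M))" using M(1) by (intro mult_left_mono) (auto simp: r_def)
    also have "\<dots> < D" using M(1) D by simp
    finally show "M * r < D" .
  qed (use D M \<open>\<rho> > 0\<close> in \<open>auto simp: r_def\<close>)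
  define \<delta> where "\<delta> = min (D / 2) (r * D)"
  have \<delta>: "\<delta> > 0" "\<delta> < D" "\<delta> \<le> r * D" using D r by (auto simp: \<delta>_def)
  show ?thesis
  proof (rule that[OF \<delta>(1)])
    fix h assume h: "\<And>i. v (coeff h i) * A ^ i \<le> \<delta>"
    have sh: "v (coeff (pcompose h [:a, 1:]) i) \<le> \<delta>" for i
      using h A by (rule v_coeff_shift_le)
    have "v (poly h a) \<le> r * D" using sh[of 0] \<delta>(3) by simp
    then have val: "v (poly (f + h) a) \<le> r * D" using a(1) by simp
    have "v (poly (pderiv h) a) < D" using sh[of 1] \<delta>(2) unfolding coeff_1_shift by simp
    then have *: "v (poly (pderiv (f + h)) a) = D"
      using v_add_dominant[of "poly (pderiv h) a" "poly (pderiv f) a"] by (simp add: D_def pderiv_add)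
    have sh': "v (coeff (pcompose (f + h) [:a, 1:]) i) \<le> M" for i
      using v_add_le[OF M(3)[of i], of "coeff (pcompose h [:a, 1:]) i"] sh[of i] \<delta>(2) M(2)
      by (simp add: pcompose_add)
    obtain b where "v (b - a) \<le> r" "poly (f + h) b = 0" "poly (pderiv (f + h)) b \<noteq> 0"
      using simple_root_near[of "f + h" a M r, OF sh'] r val unfolding * by (metis less_imp_le)
    then show "\<exists>b. v (b - a) \<le> \<rho> \<and> poly (f + h) b = 0 \<and> poly (pderiv (f + h)) b \<noteq> 0"
      using r(3) by (meson order_trans)
  qed
qed

text \<open>
  The derivative of \<open>x ^ N - a\<close> vanishes only at the origin, so nonzero \<open>N\<close>-th powers stay
  \<open>N\<close>-th powers under small perturbations.
\<close>
lemma powers_open: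
  assumes "N > 0" "x \<noteq> 0"
  obtains \<rho> where "\<rho> > 0" and "\<And>b. v (b - x ^ N) \<le> \<rho> \<Longrightarrow> b \<in> range (\<lambda>x. x ^ N)"
proof -
  let ?f = "monom 1 N - [:x ^ N:]"
  have "poly ?f x = 0" "poly (pderiv ?f) x \<noteq> 0"
    using assms by (simp_all add: poly_monom pderiv_diff pderiv_monom pderiv_pCons)
  then obtain \<delta> where \<delta>: "\<delta> > 0" "\<And>h. (\<And>i. v (coeff h i) * (max 1 (v x)) ^ i \<le> \<delta>) \<Longrightarrow>
      \<exists>b. v (b - x) \<le> 1 \<and> poly (?f + h) b = 0 \<and> poly (pderiv (?f + h)) b \<noteq> 0"
    using simple_root_stable[of ?f x "max 1 (v x)" 1] by auto
  have "b \<in> range (\<lambda>x. x ^ N)" if "v (b - x ^ N) \<le> \<delta>" for b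
  proof -
    have "v (coeff [:x ^ N - b:] i) * (max 1 (v x)) ^ i \<le> \<delta>" for i
      using that \<delta>(1) by (cases i) (auto simp: v_diff_commute)
    from \<delta>(2)[OF this] obtain y where "poly (?f + [:x ^ N - b:]) y = 0" by blast
    then have "b = y ^ N" by (simp add: poly_monom)
    then show ?thesis by simp
  qed
  with \<delta>(1) show ?thesis by (rule that)
qed

end

section \<open>Roots of unity from the residue field\<close>

context nonarch_valued_field
begin

text \<open>
  A system of representatives turns computations in the residue field into congruences modulo the
  maximal ideal, that is, into inequalities \<open>v (x - y) < 1\<close>.
\<close>
lemma residue_representatives:
  assumes "finite (residue_field v)"
  obtains T where "finite T" "card T = card (residue_field v)" "\<And>x. x \<in> T \<Longrightarrow> v x \<le> 1"
    and "\<And>x. v x \<le> 1 \<Longrightarrow> \<exists>y\<in>T. v (x - y) < 1"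
    and "\<And>x y. x \<in> T \<Longrightarrow> y \<in> T \<Longrightarrow> v (x - y) < 1 \<Longrightarrow> x = y"
proof -
  let ?O = "valuation_ring v"
  define E where "E = {(x, y). x \<in> ?O \<and> y \<in> ?O \<and> x - y \<in> maximal_ideal v}"
  have E: "(x, y) \<in> E \<longleftrightarrow> v x \<le> 1 \<and> v y \<le> 1 \<and> v (x - y) < 1" for x y
    by (simp add: E_def valuation_ring_def maximal_ideal_def)
  have Q: "residue_field v = ?O // E"
    by (simp add: residue_field_def E_def)
  have "equiv ?O E"
  proof (rule equivI)
    show "E \<subseteq> ?O \<times> ?O" by (auto simp: E valuation_ring_def)
    show "refl_on ?O E" by (auto simp: refl_on_def E valuation_ring_def)
    show "sym E" by (auto simp: sym_def E v_diff_commute)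
    show "trans E"
      unfolding trans_def E using v_triangle_less by blast
  qed
  note eq = this
  define rep where "rep C = (SOME x. x \<in> C)" for C :: "'a set"
  have rep: "rep C \<in> C" "v (rep C) \<le> 1" "E `` {rep C} = C" if "C \<in> residue_field v" for C
  proof -
    obtain x where x: "C = E `` {x}" "x \<in> ?O"
      using \<open>C \<in> residue_field v\<close> unfolding Q by (rule quotientE)
    then have "x \<in> C" using equiv_class_self[OF eq] by simp
    then show *: "rep C \<in> C" unfolding rep_def by (rule someI)
    then have "(x, rep C) \<in> E" using x by simp
    then show "v (rep C) \<le> 1" "E `` {rep C} = C"
      using equiv_class_eq[OF eq] x by (auto simp: E)
  qed
  show ?thesis
  proof (rule that[of "rep ` residue_field v"])
    show "finite (rep ` residue_field v)" using assms by simp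
    have "inj_on rep (residue_field v)" by (intro inj_onI) (metis rep(3))
    then show "card (rep ` residue_field v) = card (residue_field v)" by (rule card_image)
    show "v x \<le> 1" if "x \<in> rep ` residue_field v" for x using that rep(2) by auto
    show "\<exists>y\<in>rep ` residue_field v. v (x - y) < 1" if "v x \<le> 1" for x
    proof -
      have C: "E `` {x} \<in> residue_field v"
        unfolding Q using that by (intro quotientI) (simp add: valuation_ring_def)
      from rep(1)[OF C] have "v (x - rep (E `` {x})) < 1" by (simp add: E)
      with C show ?thesis by blast
    qed
    show "x = y" if xy: "x \<in> rep ` residue_field v" "y \<in> rep ` residue_field v" "v (x - y) < 1" for x y
    proof -
      obtain C D where CD: "x = rep C" "y = rep D" "C \<in> residue_field v" "D \<in> residue_field v"
        using xy(1,2) by blast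
      then have "(x, y) \<in> E" using rep(2) xy(3) by (simp add: E)
      then have "E `` {x} = E `` {y}" by (rule equiv_class_eq[OF eq])
      then show ?thesis using rep(3) CD by metis
    qed
  qed
qed

text \<open>
  Translation by \<open>1\<close> permutes the residue classes, so the sum of all classes does not change when
  the class of \<open>1\<close> is added \<open>q\<close> times. Likewise multiplication by a unit \<open>u\<close> permutes the \<open>q - 1\<close>
  nonzero classes, and comparing their products gives \<open>u ^ (q - 1) = 1\<close> in the residue field.
\<close>
lemma residue_unit_power:
  assumes "finite (residue_field v)"
  obtains T where "finite T" "card T = card (residue_field v) - 1"
    and "\<And>x y. x \<in> T \<Longrightarrow> y \<in> T \<Longrightarrow> v (x - y) < 1 \<Longrightarrow> x = y"
    and "\<And>x. x \<in> T \<Longrightarrow> v x = 1 \<and> v (x ^ (card (residue_field v) - 1) - 1) < 1"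
    and "v (of_nat (card (residue_field v))) < 1"
proof -
  obtain T where T: "finite T" "card T = card (residue_field v)" "\<And>x. x \<in> T \<Longrightarrow> v x \<le> 1"
    and repT: "\<And>x. v x \<le> 1 \<Longrightarrow> \<exists>y\<in>T. v (x - y) < 1"
    and uniq: "\<And>x y. x \<in> T \<Longrightarrow> y \<in> T \<Longrightarrow> v (x - y) < 1 \<Longrightarrow> x = y"
    using residue_representatives[OF assms] by metis
  define \<rho> where "\<rho> x = (SOME y. y \<in> T \<and> v (x - y) < 1)" for x
  have \<rho>: "\<rho> x \<in> T" "v (x - \<rho> x) < 1" if "v x \<le> 1" for x
    using someI_ex[of "\<lambda>y. y \<in> T \<and> v (x - y) < 1"] repT[OF that] unfolding \<rho>_def by blast+
  have \<rho>_eqD: "v (x - y) < 1" if "\<rho> x = \<rho> y" "v x \<le> 1" "v y \<le> 1" for x y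
  proof (rule v_triangle_less)
    show "v (x - \<rho> x) < 1" by (rule \<rho>(2)[OF that(2)])
    show "v (\<rho> x - y) < 1" using \<rho>(2)[OF that(3)] that(1) by (simp add: v_diff_commute)
  qed
  have "v (of_nat (card T)) < 1"
  proof -
    have le: "v (x + 1) \<le> 1" if "x \<in> T" for x using T(3)[OF that] by (intro v_add_le) auto
    have "inj_on (\<lambda>x. \<rho> (x + 1)) T"
    proof (intro inj_onI)
      fix x y assume "x \<in> T" "y \<in> T" "\<rho> (x + 1) = \<rho> (y + 1)"
      with \<rho>_eqD[of "x + 1" "y + 1"] le have "v (x - y) < 1" by simp
      with \<open>x \<in> T\<close> \<open>y \<in> T\<close> show "x = y" by (rule uniq)
    qed
    moreover have "(\<lambda>x. \<rho> (x + 1)) ` T \<subseteq> T" using \<rho>(1) le by blast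
    ultimately have "(\<lambda>x. \<rho> (x + 1)) ` T = T" using T(1) by (intro endo_inj_surj)
    then have "(\<Sum>x\<in>T. \<rho> (x + 1)) = \<Sum>T"
      using sum.reindex[OF \<open>inj_on _ T\<close>, of "\<lambda>x. x"] by simp
    then have "of_nat (card T) = (\<Sum>x\<in>T. (x + 1) - \<rho> (x + 1))"
      by (simp add: sum_subtractf sum.distrib)
    also have "v \<dots> < 1" using \<rho>(2) le by (intro v_sum_less) auto
    finally show ?thesis .
  qed
  note q = this
  define U where "U = {x \<in> T. v x = 1}"
  (* Among the representatives only that of 0 is not a unit. *)
  have "U = T - {\<rho> 0}"
  proof -
    have "v x = 1 \<longleftrightarrow> x \<noteq> \<rho> 0" if "x \<in> T" for x
    proof
      assume "v x = 1" then show "x \<noteq> \<rho> 0" using \<rho>(2)[of 0] by auto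
    next
      assume "x \<noteq> \<rho> 0"
      then have "\<not> v (x - \<rho> 0) < 1" using uniq[OF that \<rho>(1)[of 0]] by auto
      then have "\<not> v x < 1" using v_diff_less[of x 1 "\<rho> 0"] \<rho>(2)[of 0] by auto
      then show "v x = 1" using T(3)[OF that] by simp
    qed
    then show ?thesis unfolding U_def by blast
  qed
  then have U: "finite U" "card U = card (residue_field v) - 1"
    using T \<rho>(1)[of 0] by auto
  have UT: "x \<in> T" "v x = 1" if "x \<in> U" for x using that by (auto simp: U_def)
  have "v (u ^ card U - 1) < 1" if u: "u \<in> U" for u
  proof -
    have le: "v (u * x) \<le> 1" if "x \<in> U" for x using UT that u by (simp add: v_mult)
    have "inj_on (\<lambda>x. \<rho> (u * x)) U"
    proof (intro inj_onI)
      fix x y assume xy: "x \<in> U" "y \<in> U" "\<rho> (u * x) = \<rho> (u * y)"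
      with \<rho>_eqD[of "u * x" "u * y"] le have "v (u * (x - y)) < 1" by (simp add: right_diff_distrib)
      then have "v (x - y) < 1" using UT[OF u] by (simp add: v_mult)
      then show "x = y" using UT xy uniq by blast
    qed
    moreover have "(\<lambda>x. \<rho> (u * x)) ` U \<subseteq> U"
    proof (intro image_subsetI)
      fix x assume x: "x \<in> U"
      have "v (u * x) = 1" using UT x u by (simp add: v_mult)
      then have "v (\<rho> (u * x)) = 1"
        using v_eq_of_close[of "\<rho> (u * x)" "u * x"] \<rho>(2)[of "u * x"] by (simp add: v_diff_commute)
      then show "\<rho> (u * x) \<in> U" using \<rho>(1)[OF le[OF x]] by (simp add: U_def)
    qed
    ultimately have "(\<lambda>x. \<rho> (u * x)) ` U = U" using U(1) by (intro endo_inj_surj)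
    then have "(\<Prod>x\<in>U. \<rho> (u * x)) = \<Prod>U"
      using prod.reindex[OF \<open>inj_on _ U\<close>, of "\<lambda>x. x"] by simp
    moreover have "v ((\<Prod>x\<in>U. u * x) - (\<Prod>x\<in>U. \<rho> (u * x))) < 1"
      using U(1) le \<rho> T(3) by (intro v_prod_diff_less_1) auto
    ultimately have "v ((u ^ card U - 1) * \<Prod>U) < 1"
      by (simp add: prod.distrib left_diff_distrib)
    moreover have "v (\<Prod>U) = 1"
      using U(1) UT(2) by (induction U rule: finite_induct) (auto simp: v_mult)
    ultimately show ?thesis by (simp add: v_mult)
  qed
  then show ?thesis
    using that[of U] U UT uniq q T(2) by simp
qed

end

context complete_valued_field
begin

text \<open>
  Each of the \<open>q - 1\<close> nonzero residue classes consists of approximate roots of \<open>x ^ (q - 1) - 1\<close>, at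
  which the derivative is a unit because \<open>q - 1\<close> is one. Newton's method finds a root in every
  class.
\<close>
lemma card_roots_of_unity_ge:
  assumes "card (residue_field v) - 1 > 0"
  shows "card {z :: 'a. z ^ (card (residue_field v) - 1) = 1} \<ge> card (residue_field v) - 1"
proof -
  define N where "N = card (residue_field v) - 1"
  have N: "N > 0" using assms by (simp add: N_def)
  then have "finite (residue_field v)" unfolding N_def by (intro card_ge_0_finite) simp
  then obtain T where T: "finite T" "card T = N"
    and uniq: "\<And>x y. x \<in> T \<Longrightarrow> y \<in> T \<Longrightarrow> v (x - y) < 1 \<Longrightarrow> x = y"
    and pow: "\<And>x. x \<in> T \<Longrightarrow> v x = 1 \<and> v (x ^ N - 1) < 1"
    and q: "v (of_nat (card (residue_field v))) < 1"
    unfolding N_def by (rule residue_unit_power) blast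
  have vN: "v (of_nat N) = 1"
  proof -
    have "card (residue_field v) = Suc N" using N by (simp add: N_def)
    then have "of_nat N = (-1 + of_nat (card (residue_field v)) :: 'a)" by simp
    then show ?thesis using v_add_dominant[OF q[folded v_1 v_minus[of 1]]] q
      using v_add_dominant[of "of_nat (card (residue_field v))" "-1"] by (simp only:) simp
  qed
  have "\<exists>z. v (z - u) < 1 \<and> z ^ N = 1" if u: "u \<in> T" for u
  proof -
    let ?g = "monom 1 N - 1 :: 'a poly"
    have "v (coeff ?g i) * 1 ^ i \<le> 1" for i
      by (auto simp: coeff_monom intro!: v_diff_le split: if_splits)
    then have M: "v (coeff (pcompose ?g [:u, 1:]) i) \<le> 1" for i
      by (rule v_coeff_shift_le) (use pow[OF u] in auto)
    have "v (poly (pderiv ?g) u) = 1"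
      using pow[OF u] vN by (simp add: pderiv_diff pderiv_monom poly_monom v_mult v_power)
    moreover have "poly ?g u = u ^ N - 1" by (simp add: poly_monom)
    ultimately obtain z where "v (z - u) \<le> v (u ^ N - 1)" "poly ?g z = 0"
      using simple_root_near[of ?g u 1 "v (u ^ N - 1)", OF M] pow[OF u] by auto
    then show ?thesis using pow[OF u] by (intro exI[of _ z]) (auto simp: poly_monom)
  qed
  then obtain \<zeta> where \<zeta>: "\<And>u. u \<in> T \<Longrightarrow> v (\<zeta> u - u) < 1" "\<And>u. u \<in> T \<Longrightarrow> \<zeta> u ^ N = 1"
    by metis
  have "inj_on \<zeta> T"
  proof (intro inj_onI)
    fix x y assume xy: "x \<in> T" "y \<in> T" "\<zeta> x = \<zeta> y"
    then have "v (x - \<zeta> x) < 1" "v (\<zeta> x - y) < 1"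
      using \<zeta>(1)[of x] \<zeta>(1)[of y] by (simp_all add: v_diff_commute)
    then have "v (x - y) < 1" by (rule v_triangle_less)
    with xy uniq show "x = y" by blast
  qed
  then have "N = card (\<zeta> ` T)" using T by (simp add: card_image)
  also have "\<dots> \<le> card {z :: 'a. z ^ N = 1}"
  proof (rule card_mono)
    have "{z :: 'a. z ^ N = 1} = {z. poly (monom 1 N - 1) z = 0}" by (auto simp: poly_monom)
    moreover have "monom 1 N - 1 \<noteq> (0 :: 'a poly)"
      using N by (auto simp: poly_eq_iff coeff_monom intro!: exI[of _ N])
    ultimately show "finite {z :: 'a. z ^ N = 1}" using poly_roots_finite by metis
  qed (use \<zeta>(2) in auto)
  finally show ?thesis unfolding N_def .
qed

end

section \<open>Rational approximation\<close>

locale padic_valued_field = complete_valued_field v for v :: "'a::field_char_0 \<Rightarrow> real" +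
  fixes p :: nat
  assumes p_ge_2: "p \<ge> 2" and v_p: "v (of_nat p) < 1"
begin

lemma v_p_power_le:
  assumes "\<epsilon> > 0"
  obtains j where "\<And>l. l \<ge> j \<Longrightarrow> v (of_nat p ^ l) \<le> \<epsilon>"
proof -
  have "(\<lambda>l. v (of_nat p) ^ l) \<longlonglongrightarrow> 0" using v_p by (intro LIMSEQ_power_zero) auto
  from order_tendstoD(2)[OF this assms] obtain j where "\<And>l. l \<ge> j \<Longrightarrow> v (of_nat p) ^ l < \<epsilon>"
    by (auto simp: eventually_sequentially)
  then show ?thesis by (intro that[of j]) (auto simp: v_power less_imp_le)
qed

lemma small_rational_avoiding:
  assumes "\<epsilon> > 0"
  obtains \<kappa> where "\<kappa> \<in> \<rat>" "\<kappa> \<noteq> 0" "\<kappa> \<noteq> x" "v \<kappa> \<le> \<epsilon>"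
proof -
  obtain j where j: "\<And>l. l \<ge> j \<Longrightarrow> v (of_nat p ^ l) \<le> \<epsilon>" using v_p_power_le[OF assms] by blast
  have "(of_nat p ^ j :: 'a) \<noteq> of_nat p ^ Suc j"
    using p_ge_2 of_nat_eq_1_iff[of p, where ?'a = 'a] by auto
  then have "of_nat p ^ j \<noteq> x \<or> of_nat p ^ Suc j \<noteq> x" by metis
  then show ?thesis
  proof
    assume "of_nat p ^ j \<noteq> x"
    then show ?thesis using that[of "of_nat p ^ j"] j[of j] p_ge_2 by simp
  next
    assume "of_nat p ^ Suc j \<noteq> x"
    then show ?thesis using that[of "of_nat p ^ Suc j"] j[of "Suc j"] p_ge_2 by simp
  qed
qed

text \<open>
  Every nonzero rational number \<open>w = \<alpha> / \<beta>\<close> is \<open>m R\<^sup>s\<close> for a large \<open>R = (1 / (\<beta>\<^sup>2 p\<^sup>l))\<^sup>N\<close> and an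
  integer \<open>m\<close>. If this integer is negative, multiplying it by \<open>1 - p\<^sup>l\<close>, which is close to \<open>1\<close>, makes it
  positive.
\<close>
lemma rational_eq_nat_mult_power:
  assumes w: "w \<in> \<rat>" "w \<noteq> 0" and "s > 0" "N > 0" and \<epsilon>: "\<epsilon> > 0"
  obtains m X where "m > 0" "X \<in> \<rat>" "X \<noteq> 0" "v (X ^ N) \<ge> L"
    and "v (of_nat m * (X ^ N) ^ s / w - 1) \<le> \<epsilon>"
proof -
  obtain \<alpha> \<beta> where \<beta>0: "\<beta> > 0" and w_eq: "w = of_int \<alpha> / of_int \<beta>"
    using w(1) by (auto elim: Rats_cases')
  have \<beta>: "\<beta> \<noteq> 0" and \<alpha>: "\<alpha> \<noteq> 0" using \<beta>0 w(2) w_eq by auto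
  define \<epsilon>' where "\<epsilon>' = min \<epsilon> (1 / max L 1)"
  have \<epsilon>': "\<epsilon>' > 0" "\<epsilon>' \<le> \<epsilon>" "\<epsilon>' \<le> 1 / max L 1" using \<epsilon> by (auto simp: \<epsilon>'_def)
  obtain j where j: "\<And>l. l \<ge> j \<Longrightarrow> v (of_nat p ^ l) \<le> \<epsilon>'" using v_p_power_le[OF \<epsilon>'(1)] by blast
  define l where "l = Suc j"
  define Y where "Y = \<beta>\<^sup>2 * int p ^ l"
  define X where "X = 1 / (of_int Y :: 'a)"
  have Y: "Y > 0" using \<beta> p_ge_2 by (simp add: Y_def)
  have vY: "v (of_int Y) \<le> \<epsilon>'"
  proof -
    have "v (of_int Y) = v (of_int (\<beta>\<^sup>2)) * v (of_nat p ^ l)" by (simp add: Y_def v_mult v_power)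
    also have "\<dots> \<le> 1 * \<epsilon>'" by (intro mult_mono v_of_int_le_1 j) (auto simp: l_def)
    finally show ?thesis by simp
  qed
  have "max L 1 \<le> v X"
  proof -
    have "v (of_int Y) > 0" using Y by simp
    moreover have "max L 1 * v (of_int Y) \<le> 1"
      using vY \<epsilon>'(3) pos_le_divide_eq[of "max L 1" "v (of_int Y)" 1] by (simp add: mult.commute)
    ultimately show ?thesis
      unfolding X_def v_divide v_1 by (rule pos_le_divide_eq[THEN iffD2])
  qed
  moreover from this have "v X ^ 1 \<le> v X ^ N" using \<open>N > 0\<close> by (intro power_increasing) auto
  ultimately have vXN: "v (X ^ N) \<ge> L" by (simp add: v_power)
  (* One factor \<beta> of the power of \<beta> in Y ^ (N * s) cancels the denominator of w. *)
  define E where "E = 2 * (N * s) - 1"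
  have E: "2 * (N * s) = Suc E" using \<open>s > 0\<close> \<open>N > 0\<close> by (simp add: E_def)
  define M where "M = \<alpha> * \<beta> ^ E * int p ^ (l * (N * s))"
  have M0: "M \<noteq> 0" using \<alpha> \<beta> p_ge_2 by (simp add: M_def)
  have "(of_int Y :: 'a) ^ (N * s) = of_int \<beta> ^ Suc E * of_nat p ^ (l * (N * s))"
    unfolding E[symmetric] by (simp add: Y_def power_mult_distrib power_mult[symmetric])
  then have "w * of_int Y ^ (N * s) = of_int M"
    using \<beta> by (simp add: M_def w_eq)
  moreover have "of_int Y ^ (N * s) * (X ^ N) ^ s = 1"
    using Y by (simp add: X_def power_mult[symmetric] power_mult_distrib[symmetric])
  ultimately have M: "of_int M * (X ^ N) ^ s / w = 1"
    using w(2) by (metis mult.assoc mult.right_neutral nonzero_mult_div_cancel_left)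
  define \<eta> where "\<eta> = (if M > 0 then 1 else 1 - int p ^ l)"
  have "p ^ l > 1" using p_ge_2 by (intro one_less_power) (auto simp: l_def)
  then have "int p ^ l > 1" by (metis of_nat_1 of_nat_less_iff of_nat_power)
  then have pos: "M * \<eta> > 0" using M0 by (auto simp: \<eta>_def zero_less_mult_iff)
  have "of_nat (nat (M * \<eta>)) * (X ^ N) ^ s / w = (of_int M * (X ^ N) ^ s / w) * of_int \<eta>"
    using pos by (simp add: mult_ac)
  also have "\<dots> = of_int \<eta>" using M by simp
  finally have "of_nat (nat (M * \<eta>)) * (X ^ N) ^ s / w - 1 = (of_int \<eta> - 1 :: 'a)" by simp
  moreover have "v (of_int \<eta> - 1) \<le> \<epsilon>"
    using j[of l] \<epsilon> \<epsilon>'(2) by (auto simp: \<eta>_def l_def)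
  ultimately show ?thesis
    using pos Y vXN by (intro that[of "nat (M * \<eta>)" X]) (auto simp: X_def)
qed

end

section \<open>Forcing a double root by one more term\<close>

text \<open>
  The Euler operator \<open>x d/dx\<close> acts diagonally on monomials, so evaluating its powers at a multiple root
  gives linear relations between the terms, with the exponents as coefficients.
\<close>
definition euler_deriv :: "'a::field_char_0 poly \<Rightarrow> 'a poly" where
  "euler_deriv f = pCons 0 (pderiv f)"

lemma coeff_euler_deriv: "coeff (euler_deriv f) i = of_nat i * coeff f i"
  by (cases i) (simp_all add: euler_deriv_def coeff_pderiv)

lemma euler_deriv_add: "euler_deriv (f + g) = euler_deriv f + euler_deriv g"
  by (rule poly_eqI) (simp add: coeff_euler_deriv algebra_simps)

lemma euler_deriv_monom: "euler_deriv (monom c n) = monom (of_nat n * c) n"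
  by (rule poly_eqI) (simp add: coeff_euler_deriv coeff_monom)

lemma poly_euler_deriv: "poly (euler_deriv f) x = x * poly (pderiv f) x"
  by (simp add: euler_deriv_def)

lemma poly_euler_deriv2:
  "poly (euler_deriv (euler_deriv f)) x = x * poly (pderiv f) x + x\<^sup>2 * poly (pderiv (pderiv f)) x"
  by (simp add: euler_deriv_def pderiv_pCons algebra_simps power2_eq_square)

text \<open>
  \<open>d\<close> and \<open>e\<close> are the exponents of the two terms of highest degree. Only these compete with the next
  new term at points of large absolute value.
\<close>
definition leading_exponents :: "'a::zero poly \<Rightarrow> nat \<Rightarrow> nat \<Rightarrow> bool" where
  "leading_exponents f d e \<longleftrightarrow>
     e < d \<and> coeff f d \<noteq> 0 \<and> coeff f e \<noteq> 0 \<and> (\<forall>i>e. i \<noteq> d \<longrightarrow> coeff f i = 0)"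

lemma poly_rational:
  assumes "\<And>i. coeff f i \<in> \<rat>" "x \<in> \<rat>"
  shows "poly f x \<in> \<rat>"
  unfolding poly_altdef using assms by (intro Rats_sum) simp

context nonarch_valued_field
begin

lemma v_sum_le: "c \<ge> 0 \<Longrightarrow> (\<And>i. i \<in> S \<Longrightarrow> v (f i) \<le> c) \<Longrightarrow> v (sum f S) \<le> c"
  by (induction S rule: infinite_finite_induct) (auto intro: v_add_le)

text \<open>
  Every term of degree below \<open>e\<close> loses at least one factor \<open>v R\<close> against \<open>R\<^sup>e\<close>.
\<close>
lemma v_poly_lower_terms_le:
  assumes G: "\<And>i. v (coeff g i) \<le> G" and z: "\<And>i. i \<ge> e \<Longrightarrow> coeff g i = 0" and R: "v R \<ge> 1"
  shows "v (poly g R) \<le> G * v R ^ e / v R"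
proof -
  have G0: "G \<ge> 0" using G[of 0] v_nonneg order_trans by blast
  have "v (coeff g i * R ^ i) \<le> G * v R ^ e / v R" for i
  proof (cases "i < e")
    case True
    then have "v R ^ i * v R \<le> v R ^ e"
      using R power_increasing[of "Suc i" e "v R"] by (simp add: mult.commute)
    moreover have "0 < v R" using R by linarith
    ultimately have "v R ^ i \<le> v R ^ e / v R" by (simp only: pos_le_divide_eq)
    then have "v (coeff g i) * v R ^ i \<le> G * (v R ^ e / v R)"
      using G G0 by (intro mult_mono) auto
    then show ?thesis by (simp add: v_mult v_power)
  next
    case False
    then show ?thesis using z[of i] G0 R by simp
  qed
  then show ?thesis unfolding poly_altdef using G0 R by (intro v_sum_le) auto
qed

end

context padic_valued_field
begin

text \<open>
  Let \<open>a x\<^sup>d + b x\<^sup>e\<close> be the leading part of \<open>f\<close>, and let \<open>s = d - e\<close>. For the new exponent \<open>n = d + m\<close> the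
  polynomial \<open>a' x\<^sup>d + c x\<^sup>n + b x\<^sup>e + g(x)\<close> has a root of order at least two at \<open>R \<noteq> 0\<close> iff it vanishes there and
  \<open>m a' R\<^sup>d + (m + s) b R\<^sup>e + n g(R) - R g'(R) = 0\<close>. For large \<open>R\<close> the terms of \<open>g\<close> are negligible, so
  \<open>a'\<close> is close to \<open>- (m + s) b / (m R\<^sup>s)\<close>. This is close to \<open>a\<close> as soon as \<open>m R\<^sup>s\<close> is close to
  \<open>- s b / a\<close>, because then \<open>m\<close> is \<open>p\<close>-adically small. This is where the exponent absorbs the
  size of \<open>R\<close>, and why the coefficients are kept rational: \<open>m\<close> has to be a natural number.
  The second derivative at \<open>R\<close> is dominated by \<open>(m + s) s b R\<^sup>e\<close>, hence nonzero.
\<close>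
lemma double_root_by_new_term:
  fixes f :: "'a poly"
  assumes lead: "leading_exponents f d e" and rat: "\<And>i. coeff f i \<in> \<rat>"
    and "N > 0" and A: "A \<ge> 1" and \<delta>: "\<delta> > 0"
  obtains n c c' R where "n > d" "c \<in> \<rat>" "c' \<in> \<rat>" "R \<in> \<rat>" "R \<in> range (\<lambda>x. x ^ N)" "v R > A"
    and "\<And>i. v (coeff (monom c' d + monom c n) i) * A ^ i \<le> \<delta>"
    and "poly (f + (monom c' d + monom c n)) R = 0"
    and "poly (pderiv (f + (monom c' d + monom c n))) R = 0"
    and "poly (pderiv (pderiv (f + (monom c' d + monom c n)))) R \<noteq> 0"
proof -
  define a where "a = coeff f d"
  define b where "b = coeff f e"
  define g where "g = f - monom a d - monom b e"
  define s where "s = d - e"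
  have ed: "e < d" and a0: "a \<noteq> 0" and b0: "b \<noteq> 0"
    and top: "\<And>i. i > e \<Longrightarrow> i \<noteq> d \<Longrightarrow> coeff f i = 0"
    using lead unfolding leading_exponents_def a_def b_def by blast+
  have d: "d = e + s" and s: "s > 0" using ed by (auto simp: s_def)
  have f_eq: "f = monom a d + monom b e + g" by (simp add: g_def)
  have g0: "coeff g i = 0" if "i \<ge> e" for i
    using top[of i] that ed by (auto simp: g_def coeff_monom a_def b_def)
  have abQ: "a \<in> \<rat>" "b \<in> \<rat>" using rat by (auto simp: a_def b_def)
  have gQ: "coeff g i \<in> \<rat>" for i using rat abQ by (auto simp: g_def coeff_monom)
  obtain G0 where G0: "\<And>i. v (coeff g i) * 1 ^ i \<le> G0" using coeff_bound_exists by blast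
  define G where "G = max G0 1"
  have G: "G \<ge> 1" "v (coeff g i) \<le> G" for i using G0[of i] by (auto simp: G_def)
  let ?g1 = "euler_deriv g" and ?g2 = "euler_deriv (euler_deriv g)"
  have v_nat_mult: "v (of_nat k * x) \<le> v x" for k x
    using mult_right_mono[OF v_of_nat_le_1[of k] v_nonneg[of x]] by (simp add: v_mult)
  have g1: "v (coeff ?g1 i) \<le> G" "i \<ge> e \<Longrightarrow> coeff ?g1 i = 0" for i
    using order_trans[OF v_nat_mult G(2)] g0 by (simp_all add: coeff_euler_deriv)
  have g2: "v (coeff ?g2 i) \<le> G" "i \<ge> e \<Longrightarrow> coeff ?g2 i = 0" for i
    using order_trans[OF v_nat_mult g1(1)] g0 by (simp_all add: coeff_euler_deriv)

  have va: "v a > 0" and vb: "v b > 0" and vs: "v (of_nat s) > 0" using a0 b0 s by auto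
  (* \<delta>' is the permitted change of a, and \<epsilon> the permitted relative error of m R ^ s. *)
  define \<delta>' where "\<delta>' = \<delta> / A ^ d"
  have \<delta>': "\<delta>' > 0" using \<delta> A by (simp add: \<delta>'_def)
  define w where "w = - (of_nat s * b / a)"
  have w: "w \<in> \<rat>" "w \<noteq> 0" using abQ a0 b0 s by (auto simp: w_def)
  define \<epsilon> where "\<epsilon> = min (1/2) (\<delta>' * v (of_nat s) / v a)"
  have \<epsilon>: "\<epsilon> > 0" "\<epsilon> < 1" "\<epsilon> \<le> \<delta>' * v (of_nat s) / v a"
    using \<delta>' va vs by (auto simp: \<epsilon>_def)
  define K where "K = max (max (v a) \<delta>') (max (v b) G)"
  have K: "v a \<le> K" "\<delta>' \<le> K" "v b \<le> K" "G \<le> K" "K \<ge> 0"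
    using va by (auto simp: K_def le_max_iff_disj)
  (* R must exceed six bounds. They ensure in turn that m is at most \<epsilon>, that the lower terms g change
     a by at most \<delta>', that c is small on the ball of radius A, that g does not affect the second
     derivative, that m is smaller than s, and that R lies outside the ball of radius A. *)
  define B where "B = max (max (v w / \<epsilon>) (G / (v b * \<epsilon>))) (max (K * A ^ Suc d / \<delta>)
     (max (G / (v (of_nat s) ^ 2 * v b)) (max (v w / v (of_nat s)) A)))"
  define L where "L = 1 + B"
  obtain m X where m: "m > 0" and X: "X \<in> \<rat>" "X \<noteq> 0" "v (X ^ N) \<ge> L"
    and \<eta>0: "v (of_nat m * (X ^ N) ^ s / w - 1) \<le> \<epsilon>"
    using rational_eq_nat_mult_power[OF w s \<open>N > 0\<close> \<epsilon>(1), of L] by blast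
  define R where "R = X ^ N"
  have R0: "R \<noteq> 0" and RQ: "R \<in> \<rat>" using X by (auto simp: R_def)
  have "v R > B" using X(3) by (simp add: R_def L_def)
  then have RB: "v w / \<epsilon> < v R" "G / (v b * \<epsilon>) < v R" "K * A ^ Suc d / \<delta> < v R"
      "G / (v (of_nat s) ^ 2 * v b) < v R" "v w / v (of_nat s) < v R" "A < v R"
    unfolding B_def by auto
  have R1: "v R > 1" "v R > 0" using RB(6) A by auto
  define \<eta> where "\<eta> = of_nat m * R ^ s / w"
  have \<eta>: "v (\<eta> - 1) \<le> \<epsilon>" using \<eta>0 by (simp add: \<eta>_def R_def)
  have v\<eta>: "v \<eta> = 1" using v_eq_of_close[of \<eta> 1] \<eta> \<epsilon>(2) by auto
  then have \<eta>n0: "\<eta> \<noteq> 0" by auto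
  have mRs: "of_nat m * R ^ s = \<eta> * w" using w(2) by (simp add: \<eta>_def)
  have m0: "(of_nat m :: 'a) \<noteq> 0" using m by simp
  have vm: "v (of_nat m) \<le> v w / v R"
  proof -
    have "v (of_nat m) * v R ^ s = v w"
      using arg_cong[OF mRs, of v] v\<eta> by (simp add: v_mult v_power)
    moreover have "v R \<le> v R ^ s" using power_increasing[of 1 s "v R"] s R1 by simp
    then have "v (of_nat m) * v R \<le> v (of_nat m) * v R ^ s" by (intro mult_left_mono) auto
    ultimately show ?thesis using R1 by (simp add: pos_le_divide_eq)
  qed
  have vm_\<epsilon>: "v (of_nat m) \<le> \<epsilon>"
  proof -
    have "v w / v R \<le> \<epsilon>" using RB(1) R1 \<epsilon>(1) by (simp add: field_simps)
    with vm show ?thesis by linarith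
  qed
  have vm_s: "v (of_nat m) < v (of_nat s)"
  proof -
    have "v w / v R < v (of_nat s)" using RB(5) R1 vs by (simp add: field_simps)
    with vm show ?thesis by linarith
  qed
  have vms: "v (of_nat m + of_nat s) = v (of_nat s)"
    using v_add_dominant[OF vm_s] by (simp add: add.commute)

  define n where "n = d + m"
  define E where "E = of_nat n * poly g R - poly ?g1 R"
  have tail: "v (poly g R) \<le> G * v R ^ e / v R" "v (poly ?g1 R) \<le> G * v R ^ e / v R"
      "v (poly ?g2 R) \<le> G * v R ^ e / v R"
    using R1 G g0 g1 g2 by (auto intro!: v_poly_lower_terms_le)
  have vE: "v E \<le> G * v R ^ e / v R"
    unfolding E_def by (intro v_diff_le order_trans[OF v_nat_mult] tail)
  (* The coefficients a' and c solve the two linear equations of a double root at R. *)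
  define a' where "a' = - ((of_nat m + of_nat s) * b * R ^ e + E) / (of_nat m * R ^ d)"
  define c' where "c' = a' - a"
  define c where "c = - (a' * R ^ d + b * R ^ e + poly g R) / R ^ n"
  have gRQ: "poly g R \<in> \<rat>" "poly ?g1 R \<in> \<rat>"
    using gQ RQ by (auto simp: coeff_euler_deriv intro!: poly_rational)
  then have EQ: "E \<in> \<rat>" by (simp add: E_def)
  have a'Q: "a' \<in> \<rat>" using abQ RQ EQ by (auto simp: a'_def)
  have c'Q: "c' \<in> \<rat>" using abQ a'Q by (simp add: c'_def)
  have cQ: "c \<in> \<rat>" using abQ RQ a'Q gRQ(1) by (simp add: c_def)

  have key: "of_nat m * R ^ d = - (\<eta> * of_nat s * b * R ^ e / a)"
  proof -
    have "of_nat m * R ^ d = (of_nat m * R ^ s) * R ^ e" by (simp add: d power_add mult_ac)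
    then show ?thesis by (simp add: mRs w_def)
  qed
  have c'_eq: "c' = a / (\<eta> * of_nat s) * ((of_nat m + of_nat s * (1 - \<eta>)) + E / (b * R ^ e))"
    unfolding c'_def a'_def key using a0 b0 R0 \<eta>n0 s by (simp add: field_simps)
  have vc': "v c' \<le> \<delta>'"
  proof -
    have "v (of_nat s * (1 - \<eta>)) \<le> \<epsilon>"
      using order_trans[OF v_nat_mult, of "1 - \<eta>"] \<eta> by (simp add: v_diff_commute)
    moreover have "v (E / (b * R ^ e)) \<le> \<epsilon>"
    proof -
      have "v (E / (b * R ^ e)) \<le> (G * v R ^ e / v R) / (v b * v R ^ e)"
        unfolding v_divide v_mult v_power by (rule divide_right_mono[OF vE]) simp
      also have "\<dots> = G / (v b * v R)" using R1 by (simp add: field_simps)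
      also have "\<dots> \<le> \<epsilon>" using RB(2) R1 vb \<epsilon>(1) by (simp add: field_simps)
      finally show ?thesis .
    qed
    ultimately have "v ((of_nat m + of_nat s * (1 - \<eta>)) + E / (b * R ^ e)) \<le> \<epsilon>"
      using vm_\<epsilon> by (intro v_add_le)
    then have "v c' \<le> v a / v (of_nat s) * \<epsilon>"
      unfolding c'_eq v_mult[of "a / _"] using va vs
      by (intro mult_mono) (auto simp: v_divide v_mult v\<eta>)
    also have "\<dots> \<le> v a / v (of_nat s) * (\<delta>' * v (of_nat s) / v a)"
      using \<epsilon>(3) va vs by (intro mult_left_mono) auto
    also have "\<dots> = \<delta>'" using va vs by simp
    finally show ?thesis .
  qed
  have va': "v a' \<le> K"
    using v_add_le[of c' K a] vc' K by (simp add: c'_def)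
  have Re: "v R ^ e \<le> v R ^ d" using R1 ed by (intro power_increasing) auto
  have vc: "v c * A ^ n \<le> \<delta>"
  proof -
    have "v (a' * R ^ d) \<le> K * v R ^ d" using va' by (simp add: v_mult v_power mult_right_mono)
    moreover have "v (b * R ^ e) \<le> K * v R ^ d"
      using K Re by (simp add: v_mult v_power mult_mono)
    moreover have "v (poly g R) \<le> K * v R ^ d"
    proof -
      have "G * v R ^ e / v R \<le> G * v R ^ e" using R1 G(1) by (simp add: divide_le_eq)
      also have "\<dots> \<le> K * v R ^ d" using K Re G(1) by (intro mult_mono) auto
      finally show ?thesis using tail(1) by linarith
    qed
    ultimately have "v (a' * R ^ d + b * R ^ e + poly g R) \<le> K * v R ^ d"
      by (intro v_add_le)
    then have "v c \<le> K * v R ^ d / v R ^ n"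
      unfolding c_def v_divide v_minus v_power by (intro divide_right_mono) auto
    then have "v c * A ^ n \<le> K * v R ^ d / v R ^ n * A ^ n"
      using A by (intro mult_right_mono) auto
    also have "\<dots> = K * A ^ d * (A / v R) ^ m"
      using R1 by (simp add: n_def power_add power_divide)
    also have "\<dots> \<le> K * A ^ d * (A / v R) ^ 1"
      using m A R1 RB(6) K by (intro mult_left_mono power_decreasing) (auto simp: divide_le_eq)
    also have "\<dots> = K * A ^ Suc d / v R" by simp
    also have "\<dots> \<le> \<delta>" using RB(3) R1 \<delta> by (simp add: field_simps)
    finally show ?thesis .
  qed

  let ?h = "monom c' d + monom c n"
  have F: "f + ?h = monom a' d + monom c n + monom b e + g"
    by (rule poly_eqI) (simp add: f_eq c'_def coeff_monom)
  have F0: "poly (f + ?h) R = 0"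
    unfolding F using R0 by (simp add: poly_monom c_def)
  have "of_nat m * R ^ d * a' = - ((of_nat m + of_nat s) * b * R ^ e + E)"
    using m0 R0 by (simp add: a'_def)
  then have F1': "of_nat m * (a' * R ^ d) + (of_nat m + of_nat s) * (b * R ^ e) + E = 0"
    by (simp add: algebra_simps)
  have eq0: "a' * R ^ d + c * R ^ n + b * R ^ e + poly g R = 0"
    using F0 unfolding F by (simp add: poly_monom)
  have ev1: "poly (euler_deriv (f + ?h)) R =
      of_nat d * (a' * R ^ d) + of_nat n * (c * R ^ n) + of_nat e * (b * R ^ e) + poly ?g1 R"
    unfolding F by (simp add: euler_deriv_add euler_deriv_monom poly_monom)
  have eq1: "of_nat d * (a' * R ^ d) + of_nat n * (c * R ^ n) + of_nat e * (b * R ^ e) + poly ?g1 R = 0"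
  proof -
    have "of_nat d * (a' * R ^ d) + of_nat n * (c * R ^ n) + of_nat e * (b * R ^ e) + poly ?g1 R
      = of_nat n * (a' * R ^ d + c * R ^ n + b * R ^ e + poly g R)
        - (of_nat m * (a' * R ^ d) + (of_nat m + of_nat s) * (b * R ^ e) + E)"
      by (simp add: n_def d E_def algebra_simps)
    then show ?thesis unfolding eq0 F1' by simp
  qed
  have F1: "poly (pderiv (f + ?h)) R = 0"
    using ev1 eq1 R0 by (simp add: poly_euler_deriv)
  have F2: "poly (pderiv (pderiv (f + ?h))) R \<noteq> 0"
  proof -
    (* The operator (D - n) (D - d), with D the Euler operator, removes the terms of exponents n
       and d. Modulo the two equations above it agrees with D ^ 2 at R. *)
    define r where "r = poly ?g2 R - of_nat (n + d) * poly ?g1 R + of_nat (n * d) * poly g R"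
    have "poly (euler_deriv (euler_deriv (f + ?h))) R =
      of_nat d * (of_nat d * (a' * R ^ d)) + of_nat n * (of_nat n * (c * R ^ n))
        + of_nat e * (of_nat e * (b * R ^ e)) + poly ?g2 R"
      unfolding F by (simp add: euler_deriv_add euler_deriv_monom poly_monom)
    also have "\<dots> = of_nat (n + d) * (of_nat d * (a' * R ^ d) + of_nat n * (c * R ^ n)
          + of_nat e * (b * R ^ e) + poly ?g1 R)
        - of_nat (n * d) * (a' * R ^ d + c * R ^ n + b * R ^ e + poly g R)
        + ((of_nat m + of_nat s) * of_nat s * (b * R ^ e) + r)"
      by (simp add: r_def n_def d algebra_simps)
    also have "\<dots> = (of_nat m + of_nat s) * of_nat s * (b * R ^ e) + r"
      unfolding eq0 eq1 by simp
    finally have ev2: "poly (euler_deriv (euler_deriv (f + ?h))) R = \<dots>" .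
    have "v r \<le> G * v R ^ e / v R"
      unfolding r_def by (intro v_add_le v_diff_le order_trans[OF v_nat_mult] tail)
    also have "\<dots> < v (of_nat s) ^ 2 * v b * v R ^ e"
      using RB(4) R1 vs vb by (simp add: field_simps)
    also have "\<dots> = v ((of_nat m + of_nat s) * of_nat s * (b * R ^ e))"
      by (simp add: v_mult v_power vms power2_eq_square)
    finally have "v ((of_nat m + of_nat s) * of_nat s * (b * R ^ e) + r) > 0"
      using v_add_dominant[of r "(of_nat m + of_nat s) * of_nat s * (b * R ^ e)"] v_nonneg[of r]
      by linarith
    then have "poly (euler_deriv (euler_deriv (f + ?h))) R \<noteq> 0" unfolding ev2 by simp
    then show ?thesis using F1 by (simp add: poly_euler_deriv2)
  qed
  show ?thesis
  proof (rule that[OF _ cQ c'Q RQ _ RB(6) _ F0 F1 F2])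
    show "n > d" using m by (simp add: n_def)
    show "R \<in> range (\<lambda>x. x ^ N)" by (simp add: R_def)
    have "v c' * A ^ d \<le> \<delta>" using vc' A by (simp add: \<delta>'_def pos_le_divide_eq)
    then show "v (coeff ?h i) * A ^ i \<le> \<delta>" for i
      using vc m \<delta> by (auto simp: coeff_monom n_def)
  qed
qed

end

section \<open>Two more roots for each new term\<close>

text \<open>
  The roots that count: simple ones, so that they survive perturbations, and nonzero \<open>N\<close>-th powers, so
  that the substitution of \<open>x\<^sup>N\<close> multiplies their number by \<open>N\<close>.
\<close>
definition simple_power_roots :: "nat \<Rightarrow> 'a::field_char_0 poly \<Rightarrow> 'a set" where
  "simple_power_roots N f =
     {z. z \<noteq> 0 \<and> z \<in> range (\<lambda>x. x ^ N) \<and> poly f z = 0 \<and> poly (pderiv f) z \<noteq> 0}"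

lemma poly_pderiv_linear_factor:
  fixes P :: "'a::field_char_0 poly"
  shows "poly (pderiv ([:- r, 1:] * P)) x = poly P x + (x - r) * poly (pderiv P) x"
    and "poly (pderiv (pderiv ([:- r, 1:] * P))) r = 2 * poly (pderiv P) r"
proof -
  have *: "pderiv ([:- r, 1:] * P) = P + [:- r, 1:] * pderiv P" for P
    unfolding pderiv_mult by (simp add: pderiv_pCons)
  show "poly (pderiv ([:- r, 1:] * P)) x = poly P x + (x - r) * poly (pderiv P) x"
    unfolding * by (simp add: algebra_simps)
  show "poly (pderiv (pderiv ([:- r, 1:] * P))) r = 2 * poly (pderiv P) r"
    unfolding * pderiv_add by simp
qed

lemma eventually_at_right_0_less: "c > 0 \<Longrightarrow> \<forall>\<^sub>F r in at_right (0::real). r < c"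
  by (rule eventually_at_rightI[of 0 c]) auto

context complete_valued_field
begin

text \<open>
  The perturbed roots stay within a radius \<open>\<rho>\<close> of the old ones that is smaller than all absolute
  values and mutual distances of the old roots. So they are distinct and of the same absolute value
  as before.
\<close>
lemma simple_power_roots_stable:
  assumes N: "N > 0" and Z: "finite Z" "Z \<subseteq> simple_power_roots N f"
    and A: "A \<ge> 1" "\<And>z. z \<in> Z \<Longrightarrow> v z \<le> A"
  obtains \<delta> where "\<delta> > 0" and "\<And>h. (\<And>i. v (coeff h i) * A ^ i \<le> \<delta>) \<Longrightarrow>
      \<exists>Z'. finite Z' \<and> card Z' = card Z \<and> Z' \<subseteq> simple_power_roots N (f + h) \<and> (\<forall>z\<in>Z'. v z \<le> A)"
proof -
  (* All conditions on \<rho>, and below on \<delta>, hold for sufficiently small positive values. The filter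
     at_right 0 combines those of the finitely many roots. *)
  define P where "P \<rho> z \<longleftrightarrow> \<rho> < v z \<and> (\<forall>z'\<in>Z. z' \<noteq> z \<longrightarrow> \<rho> < v (z - z')) \<and>
      (\<forall>b. v (b - z) \<le> \<rho> \<longrightarrow> b \<in> range (\<lambda>x. x ^ N))" for \<rho> z
  have "\<forall>\<^sub>F \<rho> in at_right 0. P \<rho> z" if z: "z \<in> Z" for z
  proof -
    obtain x where x: "z = x ^ N" "z \<noteq> 0" using z Z(2) by (auto simp: simple_power_roots_def)
    then have "x \<noteq> 0" using N by auto
    then obtain \<rho>0 where \<rho>0: "\<rho>0 > 0" "\<And>b. v (b - x ^ N) \<le> \<rho>0 \<Longrightarrow> b \<in> range (\<lambda>x. x ^ N)"
      using powers_open[OF N] by blast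
    have "\<forall>\<^sub>F \<rho> in at_right 0. \<rho> < \<rho>0"
      using \<rho>0(1) by (rule eventually_at_right_0_less)
    moreover have "\<forall>\<^sub>F \<rho> in at_right 0. \<rho> < v z"
      using x(2) by (intro eventually_at_right_0_less) simp
    moreover have "\<forall>\<^sub>F \<rho> in at_right 0. \<forall>z'\<in>Z. z' \<noteq> z \<longrightarrow> \<rho> < v (z - z')"
    proof (intro eventually_ball_finite Z(1) ballI)
      fix z' assume "z' \<in> Z"
      show "\<forall>\<^sub>F \<rho> in at_right 0. z' \<noteq> z \<longrightarrow> \<rho> < v (z - z')"
      proof (cases "z' = z")
        case False
        then have "\<forall>\<^sub>F \<rho> in at_right 0. \<rho> < v (z - z')"
          by (intro eventually_at_right_0_less) simp
        then show ?thesis by (rule eventually_mono) simp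
      qed simp
    qed
    ultimately show ?thesis
    proof eventually_elim
      case (elim \<rho>)
      have "b \<in> range (\<lambda>x. x ^ N)" if "v (b - z) \<le> \<rho>" for b
        using \<rho>0(2)[of b] that elim(1) x(1) by simp
      with elim show ?case unfolding P_def by blast
    qed
  qed
  then have "\<forall>\<^sub>F \<rho> in at_right 0. \<forall>z\<in>Z. P \<rho> z"
    by (intro eventually_ball_finite Z(1) ballI)
  then have "\<forall>\<^sub>F \<rho> in at_right 0. 0 < \<rho> \<and> (\<forall>z\<in>Z. P \<rho> z)"
    using eventually_at_right_less[of 0] by eventually_elim simp
  then obtain \<rho> where "0 < \<rho> \<and> (\<forall>z\<in>Z. P \<rho> z)"
    using eventually_happens'[OF trivial_limit_at_right_real] by blast
  then have \<rho>: "\<rho> > 0" "\<And>z. z \<in> Z \<Longrightarrow> P \<rho> z" by blast+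

  define Q where "Q \<delta> z \<longleftrightarrow> (\<forall>h. (\<forall>i. v (coeff h i) * A ^ i \<le> \<delta>) \<longrightarrow>
      (\<exists>b. v (b - z) \<le> \<rho> \<and> poly (f + h) b = 0 \<and> poly (pderiv (f + h)) b \<noteq> 0))" for \<delta> z
  have "\<forall>\<^sub>F \<delta> in at_right 0. Q \<delta> z" if z: "z \<in> Z" for z
  proof -
    have "poly f z = 0" "poly (pderiv f) z \<noteq> 0"
      using z Z(2) by (auto simp: simple_power_roots_def)
    then obtain \<delta>0 where \<delta>0: "\<delta>0 > 0" "\<And>h. (\<And>i. v (coeff h i) * A ^ i \<le> \<delta>0) \<Longrightarrow>
        \<exists>b. v (b - z) \<le> \<rho> \<and> poly (f + h) b = 0 \<and> poly (pderiv (f + h)) b \<noteq> 0"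
      using simple_root_stable[OF _ _ A(2)[OF z] A(1) \<rho>(1)] by blast
    have "\<forall>\<^sub>F \<delta> in at_right 0. \<delta> < \<delta>0" using \<delta>0(1) by (rule eventually_at_right_0_less)
    then show ?thesis
    proof eventually_elim
      case (elim \<delta>)
      show ?case
        unfolding Q_def
      proof (intro allI impI)
        fix h assume "\<forall>i. v (coeff h i) * A ^ i \<le> \<delta>"
        then have "v (coeff h i) * A ^ i \<le> \<delta>0" for i using elim by (meson less_imp_le order_trans)
        then show "\<exists>b. v (b - z) \<le> \<rho> \<and> poly (f + h) b = 0 \<and> poly (pderiv (f + h)) b \<noteq> 0"
          by (rule \<delta>0(2))
      qed
    qed
  qed
  then have "\<forall>\<^sub>F \<delta> in at_right 0. \<forall>z\<in>Z. Q \<delta> z"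
    by (intro eventually_ball_finite Z(1) ballI)
  then have "\<forall>\<^sub>F \<delta> in at_right 0. 0 < \<delta> \<and> (\<forall>z\<in>Z. Q \<delta> z)"
    using eventually_at_right_less[of 0] by eventually_elim simp
  then obtain \<delta> where "0 < \<delta> \<and> (\<forall>z\<in>Z. Q \<delta> z)"
    using eventually_happens'[OF trivial_limit_at_right_real] by blast
  then have \<delta>: "\<delta> > 0" "\<And>z. z \<in> Z \<Longrightarrow> Q \<delta> z" by blast+

  show ?thesis
  proof (rule that[OF \<delta>(1)])
    fix h assume h: "\<And>i. v (coeff h i) * A ^ i \<le> \<delta>"
    have "\<forall>z\<in>Z. \<exists>b. v (b - z) \<le> \<rho> \<and> poly (f + h) b = 0 \<and> poly (pderiv (f + h)) b \<noteq> 0"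
      using \<delta>(2) h unfolding Q_def by blast
    from bchoice[OF this] obtain b
      where b: "\<And>z. z \<in> Z \<Longrightarrow> v (b z - z) \<le> \<rho>" "\<And>z. z \<in> Z \<Longrightarrow> poly (f + h) (b z) = 0"
        "\<And>z. z \<in> Z \<Longrightarrow> poly (pderiv (f + h)) (b z) \<noteq> 0"
      by blast
    have vb: "v (b z) = v z" "v z > 0" "b z \<in> range (\<lambda>x. x ^ N)" if "z \<in> Z" for z
      using v_eq_of_close[of "b z" z] b(1)[OF that] \<rho>(2)[OF that] \<rho>(1) unfolding P_def
      by (auto simp del: v_pos_iff)
    have "inj_on b Z"
    proof (rule inj_onI)
      fix z z' assume zz': "z \<in> Z" "z' \<in> Z" "b z = b z'"
      have "v (z - z') \<le> \<rho>"
      proof (rule v_triangle_le)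
        show "v (z - b z) \<le> \<rho>" using b(1)[OF zz'(1)] by (simp add: v_diff_commute)
        show "v (b z - z') \<le> \<rho>" using b(1)[OF zz'(2)] zz'(3) by simp
      qed
      then show "z = z'" using \<rho>(2)[OF zz'(1)] zz'(2) unfolding P_def by force
    qed
    then have "card (b ` Z) = card Z" by (rule card_image)
    moreover have "b ` Z \<subseteq> simple_power_roots N (f + h)"
    proof (rule image_subsetI)
      fix z assume z: "z \<in> Z"
      then have "b z \<noteq> 0" using vb(1,2)[OF z] by auto
      then show "b z \<in> simple_power_roots N (f + h)"
        unfolding simple_power_roots_def using b(2,3)[OF z] vb(3)[OF z] by simp
    qed
    moreover have "\<forall>z\<in>b ` Z. v z \<le> A" using vb(1) A(2) by auto
    ultimately show "\<exists>Z'. finite Z' \<and> card Z' = card Z \<and> Z' \<subseteq> simple_power_roots N (f + h) \<and> (\<forall>z\<in>Z'. v z \<le> A)"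
      using Z(1) by (intro exI[of _ "b ` Z"]) simp
  qed
qed

end

context padic_valued_field
begin

text \<open>
  After the double root \<open>R\<close> has been created, adding \<open>\<kappa> (R\<^sup>d x\<^sup>n - R\<^sup>n x\<^sup>d)\<close> keeps \<open>R\<close> as a root and makes it
  simple. Dividing by \<open>x - R\<close> turns the other branch of the double root into a simple root of the
  quotient, which therefore survives at a point \<open>R' \<noteq> R\<close> close to \<open>R\<close>. The old roots lie in the ball
  of radius \<open>A < v R\<close>, so \<open>R\<close> and \<open>R'\<close> are new.
\<close>
lemma two_new_roots:
  fixes f :: "'a poly"
  assumes lead: "leading_exponents f d e" and rat: "\<And>i. coeff f i \<in> \<rat>" and N: "N > 0"
    and Z: "finite Z" "Z \<subseteq> simple_power_roots N f"
  obtains f' :: "'a poly" and n Z' where "leading_exponents f' n d" "\<forall>i. coeff f' i \<in> \<rat>"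
    and "{i. coeff f' i \<noteq> 0} \<subseteq> insert n {i. coeff f i \<noteq> 0}"
    and "finite Z'" "Z' \<subseteq> simple_power_roots N f'" "card Z' = card Z + 2"
proof -
  define a where "a = coeff f d"
  have ed: "e < d" and a0: "a \<noteq> 0" and top: "\<And>i. i > d \<Longrightarrow> coeff f i = 0"
    using lead unfolding leading_exponents_def a_def by auto
  have va: "v a > 0" using a0 by simp
  define A where "A = Max (insert 1 (v ` Z))"
  have A: "A \<ge> 1" "\<And>z. z \<in> Z \<Longrightarrow> v z \<le> A" using Z(1) by (auto simp: A_def)
  obtain \<delta>1 where \<delta>1: "\<delta>1 > 0" "\<And>h. (\<And>i. v (coeff h i) * A ^ i \<le> \<delta>1) \<Longrightarrow>
      \<exists>Z'. finite Z' \<and> card Z' = card Z \<and> Z' \<subseteq> simple_power_roots N (f + h) \<and> (\<forall>z\<in>Z'. v z \<le> A)"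
    using simple_power_roots_stable[OF N Z A] by blast
  define \<delta> where "\<delta> = min \<delta>1 (v a / 2)"
  have \<delta>: "\<delta> > 0" "\<delta> \<le> \<delta>1" "\<delta> \<le> v a / 2" using \<delta>1(1) va by (auto simp: \<delta>_def)
  obtain n c c' R where n: "n > d" and Q: "c \<in> \<rat>" "c' \<in> \<rat>" "R \<in> \<rat>"
    and RN: "R \<in> range (\<lambda>x. x ^ N)" and vR: "v R > A"
    and h: "\<And>i. v (coeff (monom c' d + monom c n) i) * A ^ i \<le> \<delta>"
    and r0: "poly (f + (monom c' d + monom c n)) R = 0"
    and r1: "poly (pderiv (f + (monom c' d + monom c n))) R = 0"
    and r2: "poly (pderiv (pderiv (f + (monom c' d + monom c n)))) R \<noteq> 0"
    using double_root_by_new_term[OF lead rat N A(1) \<delta>(1)] by metis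
  define f1 where "f1 = f + (monom c' d + monom c n)"
  have R0: "R \<noteq> 0" using vR A(1) by auto
  have "v (coeff (monom c' d + monom c n) i) * A ^ i \<le> \<delta>1" for i using h[of i] \<delta>(2) by linarith
  from \<delta>1(2)[OF this] obtain Z1 where Z1: "finite Z1" "card Z1 = card Z"
      "Z1 \<subseteq> simple_power_roots N f1" "\<And>z. z \<in> Z1 \<Longrightarrow> v z \<le> A"
    unfolding f1_def by blast
  obtain \<delta>2 where \<delta>2: "\<delta>2 > 0" "\<And>h. (\<And>i. v (coeff h i) * A ^ i \<le> \<delta>2) \<Longrightarrow>
      \<exists>Z'. finite Z' \<and> card Z' = card Z1 \<and> Z' \<subseteq> simple_power_roots N (f1 + h) \<and> (\<forall>z\<in>Z'. v z \<le> A)"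
    using simple_power_roots_stable[OF N Z1(1,3) A(1) Z1(4)] by blast

  obtain P1 where P1: "f1 = [:- R, 1:] * P1"
    using r0 unfolding f1_def poly_eq_0_iff_dvd by (elim dvdE)
  have "poly P1 R = 0" "poly (pderiv P1) R \<noteq> 0"
    using r1 r2 unfolding f1_def[symmetric] P1 poly_pderiv_linear_factor by simp_all
  note P1_root = this
  define h2 where "h2 = monom (R ^ d) n - monom (R ^ n) d"
  have "poly h2 R = 0" by (simp add: h2_def poly_monom)
  then obtain H2 where H2: "h2 = [:- R, 1:] * H2"
    unfolding poly_eq_0_iff_dvd by (elim dvdE)
  have "poly H2 R \<noteq> 0"
  proof -
    have "R * poly H2 R = poly (euler_deriv h2) R"
      unfolding poly_euler_deriv H2 poly_pderiv_linear_factor by simp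
    also have "euler_deriv h2 = monom (of_nat n * R ^ d) n + monom (- of_nat d * R ^ n) d"
      by (rule poly_eqI) (auto simp: coeff_euler_deriv h2_def coeff_monom)
    also have "poly \<dots> R = (of_nat n - of_nat d) * (R ^ d * R ^ n)"
      by (simp add: poly_monom algebra_simps)
    also have "\<dots> \<noteq> 0" using n R0 by simp
    finally show ?thesis by auto
  qed
  note H2_R = this
  obtain x where x: "R = x ^ N" using RN by blast
  then have "x \<noteq> 0" using R0 N by auto
  then obtain \<rho>0 where \<rho>0: "\<rho>0 > 0" "\<And>b. v (b - R) \<le> \<rho>0 \<Longrightarrow> b \<in> range (\<lambda>x. x ^ N)"
    using powers_open[OF N] x by blast
  define \<rho> where "\<rho> = min \<rho>0 (v R / 2)"
  have \<rho>: "\<rho> > 0" "\<rho> \<le> \<rho>0" "\<rho> < v R" using \<rho>0(1) vR A(1) by (auto simp: \<rho>_def)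
  obtain \<delta>3 where \<delta>3: "\<delta>3 > 0" "\<And>h. (\<And>i. v (coeff h i) * max 1 (v R) ^ i \<le> \<delta>3) \<Longrightarrow>
      \<exists>b. v (b - R) \<le> \<rho> \<and> poly (P1 + h) b = 0 \<and> poly (pderiv (P1 + h)) b \<noteq> 0"
    using simple_root_stable[OF P1_root _ _ \<rho>(1), of "max 1 (v R)"] by auto

  obtain M2 where M2: "\<And>i. v (coeff h2 i) * A ^ i \<le> M2" using coeff_bound_exists by blast
  obtain M3 where M3: "\<And>i. v (coeff H2 i) * max 1 (v R) ^ i \<le> M3" using coeff_bound_exists by blast
  (* The three bounds on \<kappa> keep the old roots, the second branch of the double root, and the nonzero
     coefficient of x ^ d. The excluded value would cancel the leading coefficient. *)
  define \<tau> where "\<tau> = min (min (\<delta>2 / max M2 1) (\<delta>3 / max M3 1)) (v a / 2 / v (R ^ n))"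
  have \<tau>: "\<tau> > 0" "\<tau> \<le> \<delta>2 / max M2 1" "\<tau> \<le> \<delta>3 / max M3 1" "\<tau> \<le> v a / 2 / v (R ^ n)"
    using \<delta>2(1) \<delta>3(1) a0 R0 by (auto simp: \<tau>_def)
  obtain \<kappa> where \<kappa>: "\<kappa> \<in> \<rat>" "\<kappa> \<noteq> 0" "\<kappa> \<noteq> - c / R ^ d" "v \<kappa> \<le> \<tau>"
    using small_rational_avoiding[OF \<tau>(1)] by blast
  have small: "v (coeff (smult \<kappa> k) i) * B ^ i \<le> D"
    if "\<And>i. v (coeff k i) * B ^ i \<le> M" "\<tau> \<le> D / max M 1" for k B M D i
  proof -
    have "v \<kappa> * (v (coeff k i) * B ^ i) \<le> \<tau> * max M 1"
    proof (cases "v (coeff k i) * B ^ i \<ge> 0")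
      case True
      then show ?thesis using \<kappa>(4) that(1)[of i] \<tau>(1) by (intro mult_mono) auto
    next
      case False
      then have "v \<kappa> * (v (coeff k i) * B ^ i) \<le> 0" by (simp add: mult_nonneg_nonpos)
      also have "0 \<le> \<tau> * max M 1" using \<tau>(1) by simp
      finally show ?thesis .
    qed
    also have "\<dots> \<le> D" using that(2) by (simp add: pos_le_divide_eq)
    finally show ?thesis by (simp add: v_mult mult.assoc)
  qed
  define f2 where "f2 = f1 + smult \<kappa> h2"
  obtain Z2 where Z2: "finite Z2" "card Z2 = card Z" "Z2 \<subseteq> simple_power_roots N f2"
      "\<And>z. z \<in> Z2 \<Longrightarrow> v z \<le> A"
    using \<delta>2(2)[OF small[OF M2 \<tau>(2)]] Z1(2) unfolding f2_def by auto
  define S where "S = P1 + smult \<kappa> H2"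
  obtain R' where R': "v (R' - R) \<le> \<rho>" "poly S R' = 0" "poly (pderiv S) R' \<noteq> 0"
    using \<delta>3(2)[OF small[OF M3 \<tau>(3)]] unfolding S_def by blast
  have f2_S: "f2 = [:- R, 1:] * S"
    unfolding f2_def S_def P1 H2 by (simp add: distrib_left)
  have SR: "poly S R \<noteq> 0" using \<kappa>(2) H2_R P1_root(1) by (simp add: S_def)
  then have "R' \<noteq> R" using R'(2) by auto
  have vR': "v R' = v R" using R'(1) \<rho>(3) by (intro v_eq_of_close) auto
  then have "R' \<noteq> 0" using R0 by auto
  have "poly f2 R = 0" "poly (pderiv f2) R \<noteq> 0"
    using SR unfolding f2_S poly_pderiv_linear_factor by simp_all
  then have R_root: "R \<in> simple_power_roots N f2"
    using R0 RN by (simp add: simple_power_roots_def)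
  have "poly f2 R' = 0" "poly (pderiv f2) R' \<noteq> 0"
    using R'(2,3) \<open>R' \<noteq> R\<close> unfolding f2_S poly_pderiv_linear_factor by simp_all
  moreover have "R' \<in> range (\<lambda>x. x ^ N)" using \<rho>0(2) R'(1) \<rho>(2) by fastforce
  ultimately have R'_root: "R' \<in> simple_power_roots N f2"
    using \<open>R' \<noteq> 0\<close> by (simp add: simple_power_roots_def)

  have coeff_f2: "coeff f2 i = (if i = d then a + c' - \<kappa> * R ^ n else if i = n then c + \<kappa> * R ^ d
      else coeff f i)" for i
    using n top[of i] by (auto simp: f2_def f1_def h2_def coeff_monom a_def algebra_simps)
  have lead_n: "c + \<kappa> * R ^ d \<noteq> 0"
  proof
    assume "c + \<kappa> * R ^ d = 0"
    then have "\<kappa> * R ^ d = - c" by (simp add: eq_neg_iff_add_eq_0 add.commute)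
    then have "\<kappa> = - c / R ^ d" using R0 by (metis nonzero_mult_div_cancel_right power_not_zero)
    then show False using \<kappa>(3) by contradiction
  qed
  have lead_d: "a + c' - \<kappa> * R ^ n \<noteq> 0"
  proof -
    have "v c' * 1 \<le> v c' * A ^ d" using A(1) by (intro mult_left_mono) auto
    also have "\<dots> \<le> v a / 2" using h[of d] n \<delta>(3) by (simp add: coeff_monom)
    finally have "v c' < v a" using va by linarith
    moreover have "v (\<kappa> * R ^ n) < v a"
    proof -
      have "v \<kappa> \<le> v a / 2 / v (R ^ n)" using \<kappa>(4) \<tau>(4) by linarith
      then have "v \<kappa> * v (R ^ n) \<le> v a / 2" using R0 by (simp add: pos_le_divide_eq)
      then show ?thesis using va unfolding v_mult by linarith
    qed
    ultimately have "v (c' - \<kappa> * R ^ n) < v a" by (rule v_diff_less)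
    then have "v (a + (c' - \<kappa> * R ^ n)) = v a" by (rule v_add_dominant)
    then show ?thesis using a0 by (auto simp: add_diff_eq)
  qed
  show ?thesis
  proof (rule that[of f2 n "insert R (insert R' Z2)"])
    show "leading_exponents f2 n d"
      unfolding leading_exponents_def coeff_f2 using n lead_n lead_d top by auto
    show "\<forall>i. coeff f2 i \<in> \<rat>"
      unfolding coeff_f2 using rat Q \<kappa>(1) by (simp add: a_def)
    show "{i. coeff f2 i \<noteq> 0} \<subseteq> insert n {i. coeff f i \<noteq> 0}"
      using a0 by (auto simp: coeff_f2 a_def split: if_splits)
    show "finite (insert R (insert R' Z2))" using Z2(1) by simp
    show "insert R (insert R' Z2) \<subseteq> simple_power_roots N f2" using R_root R'_root Z2(3) by blast
    have "R \<notin> Z2" "R' \<notin> Z2" using Z2(4)[of R] Z2(4)[of R'] vR vR' by auto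
    then show "card (insert R (insert R' Z2)) = card Z + 2"
      using Z2(1,2) \<open>R' \<noteq> R\<close> by simp
  qed
qed

lemma rational_fewnomial_with_power_roots:
  assumes N: "N > 0" and "t \<ge> 1"
  shows "\<exists>(f :: 'a poly) d e Z. leading_exponents f d e \<and> (\<forall>i. coeff f i \<in> \<rat>) \<and> num_terms f \<le> t + 1 \<and>
    finite Z \<and> Z \<subseteq> simple_power_roots N f \<and> card Z = 2 * t - 1"
  using \<open>t \<ge> 1\<close>
proof (induction t rule: nat_induct_at_least)
  case base
  let ?f = "[:-1, 1:] :: 'a poly"
  have c: "coeff ?f i = (if i = 0 then -1 else if i = 1 then 1 else 0)" for i
    by (auto simp: coeff_pCons split: nat.splits)
  have "leading_exponents ?f 1 0" "\<forall>i. coeff ?f i \<in> \<rat>"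
    unfolding leading_exponents_def c by auto
  moreover have "{i. coeff ?f i \<noteq> 0} = {0, 1}" unfolding c by auto
  then have "num_terms ?f \<le> 1 + 1" by (simp add: num_terms_def)
  moreover have "{1} \<subseteq> simple_power_roots N ?f"
    by (auto simp: simple_power_roots_def pderiv_pCons intro!: image_eqI[of _ _ 1])
  ultimately show ?case
    by (intro exI[of _ ?f] exI[of _ 1] exI[of _ 0] exI[of _ "{1}"]) simp
next
  case (Suc t)
  then obtain f :: "'a poly" and d e Z where f: "leading_exponents f d e" "\<And>i. coeff f i \<in> \<rat>"
      "num_terms f \<le> t + 1" "finite Z" "Z \<subseteq> simple_power_roots N f" "card Z = 2 * t - 1"
    by blast
  obtain f' :: "'a poly" and n Z' where f': "leading_exponents f' n d" "\<forall>i. coeff f' i \<in> \<rat>"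
      "{i. coeff f' i \<noteq> 0} \<subseteq> insert n {i. coeff f i \<noteq> 0}"
      "finite Z'" "Z' \<subseteq> simple_power_roots N f'" "card Z' = card Z + 2"
    by (rule two_new_roots[OF f(1,2) N f(4,5)]) blast
  have fin: "finite {i. coeff f i \<noteq> 0}"
    by (rule finite_subset[of _ "{..degree f}"]) (auto intro: le_degree)
  have "num_terms f' \<le> card (insert n {i. coeff f i \<noteq> 0})"
    unfolding num_terms_def using f'(3) fin by (intro card_mono) auto
  also have "\<dots> \<le> Suc (num_terms f)"
    unfolding num_terms_def using fin by (simp add: card_insert_if)
  finally have "num_terms f' \<le> Suc t + 1" using f(3) by simp
  moreover have "card Z' = 2 * Suc t - 1" using f'(6) f(6) \<open>t \<ge> 1\<close> by simp
  ultimately have new: "leading_exponents f' n d \<and> (\<forall>i. coeff f' i \<in> \<rat>) \<and> num_terms f' \<le> Suc t + 1 \<and>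
      finite Z' \<and> Z' \<subseteq> simple_power_roots N f' \<and> card Z' = 2 * Suc t - 1"
    using f' by simp
  show ?case
    by (rule exI[of _ f'], rule exI[of _ n], rule exI[of _ d], rule exI[of _ Z'], rule new)
qed

end

section \<open>Substituting a power of the variable\<close>

lemma coeff_pcompose_monom_nonzeroD:
  fixes f :: "'a::comm_semiring_1 poly"
  shows "coeff (pcompose f (monom 1 N)) k \<noteq> 0 \<Longrightarrow> \<exists>i. k = i * N \<and> coeff f i \<noteq> 0"
proof (induction f arbitrary: k)
  case (pCons a f)
  show ?case
  proof (cases "k < N \<or> coeff (pcompose f (monom 1 N)) (k - N) = 0")
    case True
    then have "coeff [:a:] k \<noteq> 0"
      using pCons.prems by (auto simp: pcompose_pCons coeff_monom_mult split: if_splits)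
    then have "k = 0 * N \<and> coeff (pCons a f) 0 \<noteq> 0" by (cases k) auto
    then show ?thesis by blast
  next
    case False
    then obtain i where "k - N = i * N" "coeff f i \<noteq> 0" using pCons.IH by blast
    moreover have "k \<ge> N" using False by simp
    ultimately have "k = Suc i * N \<and> coeff (pCons a f) (Suc i) \<noteq> 0" by simp
    then show ?thesis by blast
  qed
qed simp

lemma num_terms_pcompose_monom:
  fixes f :: "'a::comm_semiring_1 poly"
  shows "num_terms (pcompose f (monom 1 N)) \<le> num_terms f"
proof -
  have fin: "finite {i. coeff f i \<noteq> 0}"
    by (rule finite_subset[of _ "{..degree f}"]) (auto intro: le_degree)
  have "{k. coeff (pcompose f (monom 1 N)) k \<noteq> 0} \<subseteq> (\<lambda>i. i * N) ` {i. coeff f i \<noteq> 0}"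
    using coeff_pcompose_monom_nonzeroD by fastforce
  then have "num_terms (pcompose f (monom 1 N)) \<le> card ((\<lambda>i. i * N) ` {i. coeff f i \<noteq> 0})"
    unfolding num_terms_def using fin by (intro card_mono) auto
  also have "\<dots> \<le> num_terms f" unfolding num_terms_def using fin by (rule card_image_le)
  finally show ?thesis .
qed

text \<open>
  The fibres of \<open>x \<mapsto> x\<^sup>N\<close> over nonzero \<open>N\<close>-th powers are cosets of the group of \<open>N\<close>-th roots of unity.
\<close>
lemma card_power_preimage_ge:
  fixes Z :: "'a::field set"
  assumes Z: "finite Z" "Z \<subseteq> range (\<lambda>x. x ^ N)" "0 \<notin> Z"
    and fin: "finite {x. x ^ N \<in> Z}" and W: "card {w :: 'a. w ^ N = 1} \<ge> M"
  shows "card Z * M \<le> card {x. x ^ N \<in> Z}"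
proof -
  have fz: "finite {x. x ^ N = z}" if "z \<in> Z" for z
    by (rule finite_subset[OF _ fin]) (use that in auto)
  have "M \<le> card {x. x ^ N = z}" if z: "z \<in> Z" for z
  proof -
    obtain x where x: "z = x ^ N" using z Z(2) by blast
    have "x \<noteq> 0 \<or> N = 0" using x z Z(3) by (cases "N = 0") (auto simp: zero_power)
    have inj: "inj_on (\<lambda>w. x * w) {w. w ^ N = 1}" if "x \<noteq> 0" using that by (auto intro: inj_onI)
    show ?thesis
    proof (cases "x = 0")
      case True
      then have "N = 0" using \<open>x \<noteq> 0 \<or> N = 0\<close> by simp
      then show ?thesis using W x by simp
    next
      case False
      have "M \<le> card ((\<lambda>w. x * w) ` {w. w ^ N = 1})"
        using W card_image[OF inj[OF False]] by simp
      also have "\<dots> \<le> card {y. y ^ N = z}"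
        using fz[OF z] x by (intro card_mono) (auto simp: power_mult_distrib)
      finally show ?thesis .
    qed
  qed
  then have "card Z * M \<le> (\<Sum>z\<in>Z. card {x. x ^ N = z})"
    using sum_bounded_below[of Z M "\<lambda>z. card {x. x ^ N = z}"] by simp
  also have "\<dots> = card (\<Union>z\<in>Z. {x. x ^ N = z})"
    using Z(1) fz by (intro card_UN_disjoint[symmetric]) auto
  also have "(\<Union>z\<in>Z. {x. x ^ N = z}) = {x. x ^ N \<in> Z}" by auto
  finally show ?thesis .
qed

lemma B1_ge:
  fixes f :: "'a::field poly"
  assumes "f \<noteq> 0" "num_terms f \<le> t + 1" "k \<le> card {x. x \<noteq> 0 \<and> poly f x = 0}"
  shows "enat k \<le> B1 t TYPE('a)"
proof -
  have "enat k \<le> enat (card {x. x \<noteq> 0 \<and> poly f x = 0})" using assms(3) by simp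
  also have "\<dots> \<le> B1 t TYPE('a)"
    unfolding B1_def using assms(1,2) by (intro SUP_upper) simp
  finally show ?thesis .
qed

context padic_valued_field
begin

lemma B1_ge_residue:
  assumes "t \<ge> 1"
  shows "enat ((2 * t - 1) * (card (residue_field v) - 1)) \<le> B1 t TYPE('a)"
proof (cases "card (residue_field v) - 1 = 0")
  case True
  then show ?thesis by (simp add: zero_enat_def[symmetric])
next
  case False
  define N where "N = card (residue_field v) - 1"
  have N: "N > 0" using False by (simp add: N_def)
  obtain f :: "'a poly" and d e Z where f: "leading_exponents f d e" "num_terms f \<le> t + 1" "finite Z"
      "Z \<subseteq> simple_power_roots N f" "card Z = 2 * t - 1"
    using rational_fewnomial_with_power_roots[OF N assms] by blast
  let ?F = "pcompose f (monom 1 N)"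
  have "f \<noteq> 0" using f(1) by (auto simp: leading_exponents_def)
  then have F0: "?F \<noteq> 0" using N by (simp add: pcompose_eq_0_iff degree_monom_eq)
  have polyF: "poly ?F x = poly f (x ^ N)" for x by (simp add: poly_pcompose poly_monom)
  have sub: "{x. x ^ N \<in> Z} \<subseteq> {x. x \<noteq> 0 \<and> poly ?F x = 0}"
    using f(4) N by (auto simp: simple_power_roots_def polyF zero_power)
  have fin: "finite {x. x \<noteq> 0 \<and> poly ?F x = 0}"
    by (rule finite_subset[OF _ poly_roots_finite[OF F0]]) auto
  have "card Z * N \<le> card {x. x ^ N \<in> Z}"
  proof (rule card_power_preimage_ge[OF f(3)])
    show "Z \<subseteq> range (\<lambda>x. x ^ N)" "0 \<notin> Z" using f(4) by (auto simp: simple_power_roots_def)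
    show "finite {x. x ^ N \<in> Z}" using fin sub by (rule rev_finite_subset)
    show "N \<le> card {w :: 'a. w ^ N = 1}" using card_roots_of_unity_ge False unfolding N_def by simp
  qed
  also have "\<dots> \<le> card {x. x \<noteq> 0 \<and> poly ?F x = 0}" using fin sub by (rule card_mono)
  finally have "(2 * t - 1) * N \<le> \<dots>" using f(5) by simp
  moreover have "num_terms ?F \<le> t + 1" using num_terms_pcompose_monom f(2) by (rule order_trans)
  ultimately show ?thesis unfolding N_def[symmetric] using F0 by (intro B1_ge)
qed

end

lemma padic_abs_prime:
  assumes "prime p"
  shows "padic_abs p (of_nat p) = 1 / real p"
proof -
  have p: "p > 1" using assms by (rule prime_gt_1_nat)
  have "quotient_of (of_nat p) = (int p, 1)"
    using quotient_of_int[of "int p"] by simp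
  moreover have "multiplicity (int p) (int p) = 1" using p by (intro multiplicity_self) auto
  ultimately show ?thesis using p by (simp add: padic_abs_def power_int_minus inverse_eq_divide)
qed

theorem theorem1p6:
  fixes p q t :: nat
    and Qp :: "'a::field_char_0 set"
    and v :: "'a \<Rightarrow> real"
  assumes "prime p" and "odd p"
    and "padic_finite_extension p Qp v"
    and "q = card (residue_field v)"
    and "t \<ge> 1"
  shows "B1 t TYPE('a) \<ge> enat ((2 * t - 1) * (q - 1))"
proof -
  have K: "nonarch_abs v" "is_padic_numbers p Qp v" "finite_extension_of Qp"
    using assms(3) by (auto simp: padic_finite_extension_def)
  interpret nonarch_valued_field v by standard (rule K(1))
  have "cauchy_complete v UNIV"
    using K(2,3) by (intro finite_extension_complete) (auto simp: is_padic_numbers_def)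
  moreover have "v (of_nat p) < 1"
  proof -
    have "v (of_rat (of_nat p)) = 1 / real p"
      using K(2) padic_abs_prime[OF assms(1)] by (simp only: is_padic_numbers_def)
    then show ?thesis using prime_gt_1_nat[OF assms(1)] by simp
  qed
  ultimately interpret padic_valued_field v p
    using prime_ge_2_nat[OF assms(1)] by unfold_locales
  show ?thesis using B1_ge_residue[OF assms(5)] assms(4) by simp
qed

end
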